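(* For $n=1$, fix $\alpha\in(2,3)$; for $n\ge2$, fix $\alpha\in(2,4)$. Then $$\lim_{\beta\to2^+}\min\left\{|\operatorname{spt}(\mu)|\ :\ \mu\in\operatorname{argmin}_{\mathcal{P}(\mathbb{R}^n)}\mathcal{E}_{\alpha,\beta}\right\}=+\infty.$$
   Context: $\mathcal{P}(\mathbb{R}^n)$ is the set of Borel probability measures on $\mathbb{R}^n$, $\operatorname{spt}(\mu)$ is the support of $\mu$, and $|A|$ denotes the cardinality of a set $A$. For $\alpha>\beta>0$, $\mathcal{E}_{\alpha,\beta}[\mu]=\frac12\iint_{\mathbb{R}^n\times\mathbb{R}^n}\left(\frac{|x-y|^\alpha}{\alpha}-\frac{|x-y|^\beta}{\beta}\right)d\mu(x)d\mu(y)$, and $\operatorname{argmin}_{\mathcal{P}(\mathbb{R}^n)}\mathcal{E}_{\alpha,\beta}$ is the set of its global minimizers on $\mathcal{P}(\mathbb{R}^n)$. (It is known that global minimizers exist and that for $\alpha>\beta>2$ each of them has finite support.) *)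

theory Defs
  imports "HOL-Probability.Probability"
begin

definition borel_prob_measures :: "'a::topological_space measure set" where
  "borel_prob_measures = {\<mu>. prob_space \<mu> \<and> sets \<mu> = sets borel}"

definition spt :: "'a::topological_space measure \<Rightarrow> 'a set" where
  "spt \<mu> = {x. \<forall>U. open U \<and> x \<in> U \<longrightarrow> emeasure \<mu> U > 0}"

(* Unlike card, which is 0 on infinite sets. *)
definition ecard :: "'a set \<Rightarrow> enat" where
  "ecard A = (if finite A then enat (card A) else \<infinity>)"

(* Lebesgue integral with values in the extended reals, as the difference of the integrals of the
   positive and the negative part (ennreal maps negative reals to 0). The Bochner integral would
   instead assign the value 0 to a function with integral +\<infinity>. *)
definition ext_integral :: "'a measure \<Rightarrow> ('a \<Rightarrow> real) \<Rightarrow> ereal" where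
  "ext_integral M f =
     enn2ereal (\<integral>\<^sup>+ x. ennreal (f x) \<partial>M) - enn2ereal (\<integral>\<^sup>+ x. ennreal (- f x) \<partial>M)"

definition kernel :: "real \<Rightarrow> real \<Rightarrow> 'a::euclidean_space \<Rightarrow> real" where
  "kernel \<alpha> \<beta> z = norm z powr \<alpha> / \<alpha> - norm z powr \<beta> / \<beta>"

(* For \<alpha> > \<beta> > 0 the kernel is bounded below by 1/\<alpha> - 1/\<beta>, so its negative part has finite integral
   and the energy is a well-defined element of (-\<infinity>, +\<infinity>] for every probability measure. *)
definition energy :: "real \<Rightarrow> real \<Rightarrow> 'a::euclidean_space measure \<Rightarrow> ereal" where
  "energy \<alpha> \<beta> \<mu> = ereal (1/2) * ext_integral (\<mu> \<Otimes>\<^sub>M \<mu>) (\<lambda>(x, y). kernel \<alpha> \<beta> (x - y))"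

definition minimizers :: "real \<Rightarrow> real \<Rightarrow> 'a::euclidean_space measure set" where
  "minimizers \<alpha> \<beta> = {\<mu>. is_arg_min (energy \<alpha> \<beta>) (\<lambda>\<nu>. \<nu> \<in> borel_prob_measures) \<mu>}"

(* enat is well-ordered, so an infimum over a nonempty set is attained, i.e. is a minimum. *)
lemma Inf_enat_attained:
  fixes A :: "enat set"
  assumes "A \<noteq> {}"
  shows "Inf A \<in> A" and "\<forall>a\<in>A. Inf A \<le> a"
  using assms by (auto simp: Inf_enat_def intro: LeastI Least_le)

end

theory Submission
  imports Defs
begin

text \<open>
  The quadratic kernel \<open>\<beta> = 2\<close> is critical: for neutral signed weights \<open>\<nu>\<close> with vanishing first
  moment the term \<open>\<Sum> \<nu>(x) \<nu>(y) |x - y|\<^sup>2\<close> is zero, so only the power \<open>\<alpha>\<close> is felt,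
  and that term is strictly convex. The theorem follows by compactness from the fact that at \<open>\<beta> = 2\<close> no
  probability measure of finite support minimises the energy, even among finitely supported
  competitors.

  Suppose that for some \<open>N\<close> there are \<open>\<beta>\<close> arbitrarily close to \<open>2\<close> from above with a minimiser supported
  on at most \<open>N\<close> points. Such a minimiser is a finite configuration of weighted points, and the
  Euler-Lagrange condition says that its potential takes one and the same nonpositive value at all
  atoms (\<open>discrete_minimizer_potential_eq\<close>). Some atom has mass at least \<open>1/N\<close>, and the growth of the
  kernel then keeps all the others within a distance of it that depends only on \<open>\<alpha>\<close> and \<open>N\<close>
  (\<open>discrete_minimizer_diameter\<close>). After a translation a subsequence of the configurations converges,
  atoms being allowed to merge and masses to vanish. As the kernel is jointly continuous in \<open>\<beta>\<close> and the
  position, the limit minimises the energy for \<open>\<beta> = 2\<close> among finite configurations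
  (\<open>discrete_minimizer_card_unbounded\<close>).

  No such limit exists. In dimension \<open>n \<ge> 2\<close> with \<open>2 < \<alpha> < 4\<close>, move a finite minimiser by an
  isometry that fixes its centre of mass and takes one of its atoms out of its support. The copy has the
  same energy, and along the segment between two configurations with the same centre the energy is
  strictly convex, because \<open>|x - y|\<close> to the power \<open>\<alpha>\<close> is strictly positive definite on neutral weights
  with vanishing first moment (\<open>pair_sum_powr_pos\<close>); so the average of the two does better
  (\<open>no_discrete_minimizer_multidim\<close>). In dimension one a configuration symmetric about its
  centre escapes this argument, and pairs of points do minimise when \<open>\<alpha> \<ge> 3\<close>. For
  \<open>2 < \<alpha> < 3\<close>, however, the second derivative of the potential is strictly concave between
  neighbouring atoms and nonnegative at them, so the potential is strictly convex there, although both atoms minimise it (\<open>no_discrete_minimizer_dim1\<close>).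
\<close>

section \<open>Finite configurations and the Euler-Lagrange condition\<close>

definition prob_weights :: "'a set \<Rightarrow> ('a \<Rightarrow> real) \<Rightarrow> bool" where
  "prob_weights A f \<longleftrightarrow> finite A \<and> (\<forall>x. 0 \<le> f x) \<and> (\<forall>x. x \<notin> A \<longrightarrow> f x = 0) \<and> sum f A = 1"

text \<open>Twice the interaction energy of the weights, polarised to a bilinear form so that perturbations of a
  configuration can be expanded.\<close>
definition pair_sum :: "('a::real_normed_vector \<Rightarrow> real) \<Rightarrow> 'a set \<Rightarrow> ('a \<Rightarrow> real) \<Rightarrow> ('a \<Rightarrow> real) \<Rightarrow> real" where
  "pair_sum K A f g = (\<Sum>x\<in>A. \<Sum>y\<in>A. f x * g y * K (x - y))"

definition discrete_minimizer :: "('a::real_normed_vector \<Rightarrow> real) \<Rightarrow> 'a set \<Rightarrow> ('a \<Rightarrow> real) \<Rightarrow> bool" where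
  "discrete_minimizer K A f \<longleftrightarrow>
     prob_weights A f \<and> (\<forall>B g. prob_weights B g \<longrightarrow> pair_sum K A f f \<le> pair_sum K B g g)"

lemma prob_weightsD:
  assumes "prob_weights A f"
  shows "finite A" "0 \<le> f x" "x \<notin> A \<Longrightarrow> f x = 0" "sum f A = 1"
  using assms by (auto simp: prob_weights_def)

lemma pair_sum_superset:
  assumes "finite B" "A \<subseteq> B" "\<And>x. x \<notin> A \<Longrightarrow> f x = 0" "\<And>x. x \<notin> A \<Longrightarrow> g x = 0"
  shows "pair_sum K B f g = pair_sum K A f g"
proof -
  have "(\<Sum>y\<in>B. f x * g y * K (x - y)) = (\<Sum>y\<in>A. f x * g y * K (x - y))" for x
    by (rule sum.mono_neutral_right) (use assms in auto)
  then show ?thesis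
    unfolding pair_sum_def by (simp, intro sum.mono_neutral_right) (use assms in auto)
qed

lemma pair_sum_commute:
  assumes "\<And>z. K (- z) = K z"
  shows "pair_sum K A f g = pair_sum K A g f"
proof -
  have "K (x - y) = K (y - x)" for x y
    using assms[of "x - y"] by simp
  then show ?thesis
    unfolding pair_sum_def by (subst sum.swap) (simp add: mult_ac)
qed

text \<open>The polarisation identity along a segment: convexity of the energy between two configurations is the
  sign of the form on their difference. With \<open>t \<rightarrow> 0\<close> it yields the Euler-Lagrange condition, with
  \<open>t = 1/2\<close> the gain obtained by averaging two configurations.\<close>
lemma pair_sum_interpolate:
  "pair_sum K A (\<lambda>x. (1 - t) * f x + t * g x) (\<lambda>x. (1 - t) * f x + t * g x) =
         (1 - t) * pair_sum K A f f + t * pair_sum K A g g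
         - t * (1 - t) * pair_sum K A (\<lambda>x. f x - g x) (\<lambda>x. f x - g x)"
proof -
  have *: "((1 - t) * f x + t * g x) * ((1 - t) * f y + t * g y) * k =
      (1 - t) * (f x * f y * k) + t * (g x * g y * k) - t * (1 - t) * ((f x - g x) * (f y - g y) * k)"
    for x y k
    by (simp add: algebra_simps)
  show ?thesis
    unfolding pair_sum_def * sum.distrib sum_subtractf by (simp only: sum_distrib_left)
qed

lemma pair_sum_diff_square:
  assumes K: "\<And>z. K (- z) = K z"
  shows "pair_sum K A (\<lambda>x. f x - g x) (\<lambda>x. f x - g x) =
         pair_sum K A f f - 2 * pair_sum K A g f + pair_sum K A g g"
proof -
  have "pair_sum K A (\<lambda>x. f x - g x) (\<lambda>x. f x - g x) =
        pair_sum K A f f - pair_sum K A f g - pair_sum K A g f + pair_sum K A g g"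
    by (simp add: pair_sum_def left_diff_distrib right_diff_distrib sum.distrib sum_subtractf)
  then show ?thesis using pair_sum_commute[of K A f g] K by simp
qed

lemma prob_weights_combine:
  assumes f: "prob_weights A f" and g: "prob_weights B g" and t: "0 \<le> t" "t \<le> 1"
  shows "prob_weights (A \<union> B) (\<lambda>x. (1 - t) * f x + t * g x)"
proof -
  have "sum f (A \<union> B) = sum f A" "sum g (A \<union> B) = sum g B"
    by (rule sum.mono_neutral_right; use f g in \<open>auto simp: prob_weights_def\<close>)+
  then show ?thesis
    using prob_weightsD[OF f] prob_weightsD[OF g] t
    by (simp add: prob_weights_def sum.distrib sum_distrib_left[symmetric])
qed

definition dirac :: "'a \<Rightarrow> 'a \<Rightarrow> real" where
  "dirac y x = (if x = y then 1 else 0)"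

lemma prob_weights_dirac: "prob_weights {y} (dirac y)"
  by (auto simp: prob_weights_def dirac_def)

lemma sum_dirac: "finite A \<Longrightarrow> y \<in> A \<Longrightarrow> (\<Sum>x\<in>A. dirac y x * h x) = h y"
  by (simp add: dirac_def if_distrib[of "\<lambda>a. a * _"] sum.delta' cong: if_cong)

lemma pair_sum_dirac:
  assumes "finite A" "y \<in> A"
  shows "pair_sum K A (dirac y) f = (\<Sum>x\<in>A. f x * K (y - x))"
proof -
  have "pair_sum K A (dirac y) f = (\<Sum>z\<in>A. dirac y z * (\<Sum>x\<in>A. f x * K (z - x)))"
    by (simp add: pair_sum_def sum_distrib_left mult.assoc)
  then show ?thesis using sum_dirac[OF assms] by simp
qed

text \<open>First half of the Euler-Lagrange condition: moving a small fraction \<open>t\<close> of the total mass to \<open>y\<close>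
  changes the pair sum to first order by \<open>2 t\<close> times the difference of the two sides.\<close>
lemma discrete_minimizer_potential_ge:
  assumes K: "\<And>z. K (- z) = K z" "K 0 = 0" and min: "discrete_minimizer K A f"
  shows "pair_sum K A f f \<le> (\<Sum>x\<in>A. f x * K (y - x))"
proof -
  note f = min[unfolded discrete_minimizer_def, THEN conjunct1]
  define B where "B = insert y A"
  have B: "finite B" "A \<subseteq> B" "y \<in> B" and AB: "A \<union> {y} = B"
    using prob_weightsD(1)[OF f] by (auto simp: B_def)
  define Q P where "Q = pair_sum K A f f" and "P = (\<Sum>x\<in>A. f x * K (y - x))"
  have QB: "pair_sum K B f f = Q"
    unfolding Q_def by (rule pair_sum_superset) (use B prob_weightsD[OF f] in auto)
  have "(\<Sum>x\<in>B. f x * K (y - x)) = P"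
    unfolding P_def by (rule sum.mono_neutral_right) (use B prob_weightsD[OF f] in auto)
  then have PB: "pair_sum K B (dirac y) f = P"
    using pair_sum_dirac[OF B(1,3)] by simp
  have DB: "pair_sum K B (dirac y) (dirac y) = 0"
    using pair_sum_dirac[OF B(1,3)] sum_dirac[OF B(1,3)] K(2) by simp
  have *: "0 \<le> (2 * P - 2 * Q) + t * (Q - 2 * P)" if t: "0 < t" "t < 1" for t
  proof -
    have "Q \<le> pair_sum K B (\<lambda>x. (1 - t) * f x + t * dirac y x) (\<lambda>x. (1 - t) * f x + t * dirac y x)"
      using min prob_weights_combine[OF f prob_weights_dirac[of y], of t] t
      unfolding discrete_minimizer_def Q_def AB by auto
    also have "\<dots> = (1 - t) * Q - t * (1 - t) * (Q - 2 * P)"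
      unfolding pair_sum_interpolate pair_sum_diff_square[of K, OF K(1)] QB PB DB by simp
    finally have "0 \<le> t * ((2 * P - 2 * Q) + t * (Q - 2 * P))"
      by (simp add: algebra_simps)
    then show ?thesis using t by (simp add: zero_le_mult_iff)
  qed
  have "((\<lambda>t. (2 * P - 2 * Q) + t * (Q - 2 * P)) \<longlongrightarrow> (2 * P - 2 * Q) + 0 * (Q - 2 * P)) (at_right 0)"
    by (intro tendsto_intros)
  moreover have "eventually (\<lambda>t. 0 \<le> (2 * P - 2 * Q) + t * (Q - 2 * P)) (at_right (0::real))"
    using * unfolding eventually_at_right_field by (intro exI[of _ 1]) auto
  ultimately have "0 \<le> (2 * P - 2 * Q) + 0 * (Q - 2 * P)"
    by (intro tendsto_lowerbound) auto
  then show ?thesis by (simp add: P_def Q_def)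
qed

text \<open>Second half: the average of the potential against the weights is the energy itself, and the
  potential lies nowhere below it, so there can be no excess on an atom.\<close>
lemma discrete_minimizer_potential_eq:
  assumes K: "\<And>z. K (- z) = K z" "K 0 = 0" and min: "discrete_minimizer K A f" and y: "f y > 0"
  shows "(\<Sum>x\<in>A. f x * K (y - x)) = pair_sum K A f f"
proof -
  note f = min[unfolded discrete_minimizer_def, THEN conjunct1]
  define P where "P = (\<lambda>y. \<Sum>x\<in>A. f x * K (y - x))"
  define Q where "Q = pair_sum K A f f"
  have "(\<Sum>y\<in>A. f y * (P y - Q)) = (\<Sum>y\<in>A. f y * P y) - (\<Sum>y\<in>A. f y) * Q"
    by (simp add: right_diff_distrib sum_subtractf sum_distrib_right)
  also have "(\<Sum>y\<in>A. f y * P y) = Q"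
    by (simp add: P_def Q_def pair_sum_def sum_distrib_left mult.assoc)
  finally have "(\<Sum>y\<in>A. f y * (P y - Q)) = 0"
    using prob_weightsD(4)[OF f] by simp
  moreover have "0 \<le> f z * (P z - Q)" for z
    using discrete_minimizer_potential_ge[OF K min, of z] prob_weightsD(2)[OF f]
    by (simp add: P_def Q_def)
  ultimately have "\<forall>z\<in>A. f z * (P z - Q) = 0"
    using prob_weightsD(1)[OF f] by (subst (asm) sum_nonneg_eq_0_iff) auto
  moreover have "y \<in> A" using y prob_weightsD(3)[OF f] by force
  ultimately show ?thesis using y by (auto simp: P_def Q_def)
qed

text \<open>The competitor is a single point mass, whose energy vanishes.\<close>
lemma discrete_minimizer_energy_le_0:
  assumes "K 0 = 0" "discrete_minimizer K A f"
  shows "pair_sum K A f f \<le> 0"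
proof -
  have "pair_sum K A f f \<le> pair_sum K {0} (dirac 0) (dirac 0)"
    using assms(2) prob_weights_dirac[of 0] by (auto simp: discrete_minimizer_def)
  then show ?thesis using assms(1) by (simp add: pair_sum_def)
qed

text \<open>For limits of configurations with at most \<open>N\<close> points it is convenient to index the points by
  \<open>{..<N}\<close>, padding with massless copies of an atom. Placing all the \<open>p i\<close> at atoms, the padding included,
  makes bounds on the positions of atoms available for every index.\<close>
lemma prob_weights_imp_tuple:
  assumes f: "prob_weights A f" and N: "card A \<le> N"
  obtains m :: "nat \<Rightarrow> real" and p :: "nat \<Rightarrow> 'a"
  where "\<And>i. 0 \<le> m i" "\<And>i. m i \<le> 1" "(\<Sum>i<N. m i) = 1" "\<And>i. p i \<in> {x \<in> A. f x > 0}"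
    "\<And>h. (\<Sum>x\<in>A. f x * h x) = (\<Sum>i<N. m i * h (p i))"
proof -
  define S where "S = {x \<in> A. f x > 0}"
  have S: "finite S" "S \<subseteq> A" "\<And>x. x \<notin> S \<Longrightarrow> f x = 0"
    using prob_weightsD[OF f] by (auto simp: S_def antisym_conv not_less)
  have sumS: "(\<Sum>x\<in>A. f x * h x) = (\<Sum>x\<in>S. f x * h x)" for h
    by (rule sum.mono_neutral_right) (use S prob_weightsD(1)[OF f] in auto)
  have "S \<noteq> {}" using sumS[of "\<lambda>_. 1"] prob_weightsD(4)[OF f] by auto
  then have c: "card S > 0" "card S \<le> N"
    using S N prob_weightsD(1)[OF f] card_mono[of A S] by (auto simp: card_gt_0_iff)
  obtain e where e: "bij_betw e {0..<card S} S"
    using ex_bij_betw_nat_finite[OF S(1)] by blast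
  define m where "m i = (if i < card S then f (e i) else 0)" for i
  define p where "p i = e (if i < card S then i else 0)" for i
  have 1: "(\<Sum>x\<in>A. f x * h x) = (\<Sum>i<N. m i * h (p i))" for h
  proof -
    have "(\<Sum>i<N. m i * h (p i)) = (\<Sum>i\<in>{0..<card S}. m i * h (p i))"
      by (rule sum.mono_neutral_right) (use c in \<open>auto simp: m_def\<close>)
    also have "\<dots> = (\<Sum>i\<in>{0..<card S}. f (e i) * h (e i))"
      by (rule sum.cong) (auto simp: m_def p_def)
    also have "\<dots> = (\<Sum>x\<in>S. f x * h x)"
      by (rule sum.reindex_bij_betw[OF e])
    finally show ?thesis using sumS by simp
  qed
  have 2: "0 \<le> m i" for i using prob_weightsD[OF f] by (simp add: m_def)
  have 3: "(\<Sum>i<N. m i) = 1" using 1[of "\<lambda>_. 1"] prob_weightsD(4)[OF f] by simp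
  have 4: "m i \<le> 1" for i
  proof (cases "i < N")
    case True
    then show ?thesis using 2 3 member_le_sum[of i "{..<N}" m] by auto
  qed (use c in \<open>auto simp: m_def\<close>)
  have 5: "p i \<in> {x \<in> A. f x > 0}" for i
    using bij_betwE[OF e] c by (auto simp: p_def S_def)
  show ?thesis by (rule that[of m p]) (use 1 2 3 4 5 in auto)
qed

text \<open>Conversely, points of a tuple that coincide are merged by adding their masses. Both passages are
  described by the equality of integrals of arbitrary functions, which gives the energy by iteration.\<close>
lemma tuple_imp_prob_weights:
  assumes m: "\<And>i. i < N \<Longrightarrow> 0 \<le> m i" "(\<Sum>i<N. m i) = 1"
  obtains f where "prob_weights (p ` {..<N}) f"
    "\<And>h. (\<Sum>x\<in>p ` {..<N}. f x * h x) = (\<Sum>i<(N::nat). m i * h (p i))"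
proof -
  define f where "f x = (\<Sum>i | i < N \<and> p i = x. m i)" for x
  have 1: "(\<Sum>x\<in>p ` {..<N}. f x * h x) = (\<Sum>i<N. m i * h (p i))" for h :: "'a \<Rightarrow> real"
  proof -
    have "(\<Sum>i<N. m i * h (p i)) = (\<Sum>x\<in>p ` {..<N}. \<Sum>i\<in>{i \<in> {..<N}. p i = x}. m i * h (p i))"
      by (rule sum.image_gen) auto
    also have "\<dots> = (\<Sum>x\<in>p ` {..<N}. f x * h x)"
      by (intro sum.cong refl) (auto simp: f_def sum_distrib_right intro!: sum.cong)
    finally show ?thesis by simp
  qed
  have "f x = 0" if "x \<notin> p ` {..<N}" for x
    unfolding f_def by (rule sum.neutral) (use that in auto)
  moreover have "0 \<le> f x" for x
    unfolding f_def by (rule sum_nonneg) (use m in auto)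
  ultimately have "prob_weights (p ` {..<N}) f"
    using 1[of "\<lambda>_. 1"] m by (auto simp: prob_weights_def)
  with 1 show ?thesis using that by blast
qed

lemma pair_sum_tuple:
  assumes h: "\<And>h. (\<Sum>x\<in>A. f x * h x) = (\<Sum>i<(N::nat). m i * h (p i))"
  shows "pair_sum K A f f = (\<Sum>i<N. \<Sum>j<N. m i * m j * K (p i - p j))"
proof -
  have "pair_sum K A f f = (\<Sum>x\<in>A. f x * (\<Sum>y\<in>A. f y * K (x - y)))"
    by (simp add: pair_sum_def sum_distrib_left mult.assoc)
  also have "\<dots> = (\<Sum>i<N. m i * (\<Sum>j<N. m j * K (p i - p j)))"
    by (simp only: h)
  finally show ?thesis by (simp add: sum_distrib_left mult.assoc)
qed

section \<open>Strict positivity of powers of the distance\<close>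

text \<open>Powers of the inner product are positive semidefinite kernels: expanding one factor in coordinates
  turns the form of order \<open>k + 1\<close> into a sum of forms of order \<open>k\<close> with the weights \<open>c x * (x \<bullet> b)\<close>.\<close>
lemma pair_sum_power_inner_nonneg:
  fixes c :: "'a::euclidean_space \<Rightarrow> real"
  shows "0 \<le> (\<Sum>x\<in>A. \<Sum>y\<in>A. c x * c y * (x \<bullet> y) ^ k)"
proof (induction k arbitrary: c)
  case 0
  have "(\<Sum>x\<in>A. \<Sum>y\<in>A. c x * c y) = (\<Sum>x\<in>A. c x) * (\<Sum>y\<in>A. c y)"
    by (simp add: sum_product)
  then show ?case by simp
next
  case (Suc k)
  have "c x * c y * (x \<bullet> y) ^ Suc k =
      (\<Sum>b\<in>Basis. (c x * (x \<bullet> b)) * (c y * (y \<bullet> b)) * (x \<bullet> y) ^ k)" for x y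
    by (subst power_Suc, subst (1) euclidean_inner) (simp add: sum_distrib_left sum_distrib_right mult_ac)
  then have "(\<Sum>x\<in>A. \<Sum>y\<in>A. c x * c y * (x \<bullet> y) ^ Suc k) =
      (\<Sum>x\<in>A. \<Sum>y\<in>A. \<Sum>b\<in>Basis. (c x * (x \<bullet> b)) * (c y * (y \<bullet> b)) * (x \<bullet> y) ^ k)"
    by presburger
  also have "\<dots> = (\<Sum>x\<in>A. \<Sum>b\<in>Basis. \<Sum>y\<in>A. (c x * (x \<bullet> b)) * (c y * (y \<bullet> b)) * (x \<bullet> y) ^ k)"
    by (intro sum.cong refl sum.swap)
  also have "\<dots> = (\<Sum>b\<in>Basis. \<Sum>x\<in>A. \<Sum>y\<in>A. (c x * (x \<bullet> b)) * (c y * (y \<bullet> b)) * (x \<bullet> y) ^ k)"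
    by (rule sum.swap)
  also have "\<dots> \<ge> 0"
    by (intro sum_nonneg Suc.IH)
  finally show ?case .
qed

lemma pair_sum_exp_inner_nonneg:
  fixes c :: "'a::euclidean_space \<Rightarrow> real"
  assumes "0 \<le> t"
  shows "0 \<le> (\<Sum>x\<in>A. \<Sum>y\<in>A. c x * c y * exp (t * (x \<bullet> y)))"
proof -
  have series: "(\<lambda>k. \<Sum>x\<in>A. \<Sum>y\<in>A. c x * c y * ((t * (x \<bullet> y)) ^ k /\<^sub>R fact k)) sums
        (\<Sum>x\<in>A. \<Sum>y\<in>A. c x * c y * exp (t * (x \<bullet> y)))"
    by (intro sums_sum sums_mult exp_converges)
  have terms: "0 \<le> (\<Sum>x\<in>A. \<Sum>y\<in>A. c x * c y * ((t * (x \<bullet> y)) ^ k /\<^sub>R fact k))" for k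
  proof -
    have "(\<Sum>x\<in>A. \<Sum>y\<in>A. c x * c y * ((t * (x \<bullet> y)) ^ k /\<^sub>R fact k)) =
          t ^ k / fact k * (\<Sum>x\<in>A. \<Sum>y\<in>A. c x * c y * (x \<bullet> y) ^ k)"
      by (simp add: sum_distrib_left power_mult_distrib divide_inverse mult_ac)
    then show ?thesis
      using assms pair_sum_power_inner_nonneg[where A = A and c = c and k = k] by simp
  qed
  show ?thesis
    by (rule sums_le[OF terms sums_zero series])
qed

text \<open>The Gaussian kernel is the exponential kernel after rescaling each weight by \<open>exp (- t |x|\<^sup>2)\<close>.\<close>
lemma pair_sum_gaussian_nonneg:
  fixes c :: "'a::euclidean_space \<Rightarrow> real"
  assumes "0 \<le> t"
  shows "0 \<le> pair_sum (\<lambda>z. exp (- (t * (norm z)\<^sup>2))) A c c"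
proof -
  have "exp (- (t * (norm (x - y))\<^sup>2)) =
      exp (- (t * (norm x)\<^sup>2)) * exp (- (t * (norm y)\<^sup>2)) * exp (2 * t * (x \<bullet> y))" for x y :: 'a
    by (simp add: exp_add[symmetric] power2_norm_eq_inner inner_diff inner_commute algebra_simps)
  then have "pair_sum (\<lambda>z. exp (- (t * (norm z)\<^sup>2))) A c c =
      (\<Sum>x\<in>A. \<Sum>y\<in>A. (c x * exp (- (t * (norm x)\<^sup>2))) * (c y * exp (- (t * (norm y)\<^sup>2)))
         * exp (2 * t * (x \<bullet> y)))"
    unfolding pair_sum_def by (simp add: mult_ac)
  also have "\<dots> \<ge> 0"
    by (rule pair_sum_exp_inner_nonneg) (use assms in auto)
  finally show ?thesis .
qed

text \<open>The off-diagonal terms die out. This is where strict positivity will come from.\<close>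
lemma pair_sum_gaussian_tendsto:
  fixes c :: "'a::euclidean_space \<Rightarrow> real"
  assumes "finite A"
  shows "((\<lambda>t. pair_sum (\<lambda>z. exp (- (t * (norm z)\<^sup>2))) A c c) \<longlongrightarrow> (\<Sum>x\<in>A. (c x)\<^sup>2)) at_top"
proof -
  have lim: "((\<lambda>t. exp (- (t * (norm z)\<^sup>2))) \<longlongrightarrow> (if z = 0 then 1 else 0)) at_top" for z :: 'a
  proof (cases "z = 0")
    case False
    then have "filterlim (\<lambda>t. t * (norm z)\<^sup>2) at_top at_top"
      by (intro filterlim_at_top_mult_tendsto_pos[OF tendsto_const]) (auto simp: filterlim_ident)
    then show ?thesis
      using False by (auto intro!: filterlim_compose[OF exp_at_bot] simp: filterlim_uminus_at_top)
  qed simp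
  have "((\<lambda>t. pair_sum (\<lambda>z. exp (- (t * (norm z)\<^sup>2))) A c c) \<longlongrightarrow>
      (\<Sum>x\<in>A. \<Sum>y\<in>A. c x * c y * (if x - y = 0 then 1 else 0))) at_top"
    unfolding pair_sum_def by (intro tendsto_sum tendsto_mult tendsto_const lim)
  also have "(\<Sum>x\<in>A. \<Sum>y\<in>A. c x * c y * (if x - y = 0 then 1 else 0)) = (\<Sum>x\<in>A. (c x)\<^sup>2)"
    using assms by (auto intro!: sum.cong simp: if_distrib[of "\<lambda>a. _ * a"] power2_eq_square sum.delta cong: if_cong)
  finally show ?thesis .
qed

text \<open>For \<open>1 < a < 2\<close> the function \<open>s powr a\<close> is, up to a positive constant, the integral over \<open>t > 0\<close> of
  \<open>(exp (- t s) - 1 + t s) * t powr (- 1 - a)\<close>. The density below is the case \<open>s = 1\<close>; the others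
  follow from it by scaling.\<close>
definition exp_remainder_density :: "real \<Rightarrow> real \<Rightarrow> real" where
  "exp_remainder_density a u = indicator {0<..} u * ((exp (- u) - 1 + u) * u powr (- 1 - a))"

lemma exp_remainder_density_nonneg: "0 \<le> exp_remainder_density a u"
proof -
  have "0 \<le> exp (- u) - 1 + u" using exp_ge_add_one_self[of "- u"] by linarith
  then show ?thesis
    unfolding exp_remainder_density_def by (intro mult_nonneg_nonneg) auto
qed

lemma exp_remainder_le_square:
  assumes "0 < (u::real)" shows "exp (- u) - 1 + u \<le> u\<^sup>2"
proof -
  have "exp (- u) \<le> 1 / (1 + u)"
    using exp_ge_add_one_self[of u] assms by (simp add: exp_minus field_simps)
  also have "\<dots> \<le> 1 - u + u\<^sup>2"
    using assms by (simp add: field_simps power2_eq_square)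
  finally show ?thesis by simp
qed

text \<open>The second-order remainder is \<open>O(u\<^sup>2)\<close>, which makes the integrand \<open>O(u powr (1 - a))\<close> near \<open>0\<close>,
  integrable as \<open>a < 2\<close>; it is at most \<open>u\<close>, which makes the integrand \<open>O(u powr (- a))\<close> at infinity,
  integrable as \<open>1 < a\<close>.\<close>
lemma integrable_exp_remainder_density:
  assumes a: "1 < a" "a < 2"
  shows "integrable lborel (exp_remainder_density a)"
proof (rule Bochner_Integration.integrable_bound)
  have int: "integrable lborel (\<lambda>u. indicator S u *\<^sub>R u powr e)"
    if "((\<lambda>x. x powr e) has_integral I) S" "S \<in> sets borel" for S :: "real set" and e I
  proof -
    have "(\<lambda>x. x powr e) absolutely_integrable_on S"
      by (rule nonnegative_absolutely_integrable_1) (use that in auto)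
    then have "integrable lebesgue (\<lambda>u. indicator S u *\<^sub>R u powr e)"
      by (simp add: set_integrable_def)
    then show ?thesis
      using that(2) by (subst (asm) integrable_completion) auto
  qed
  have "integrable lborel (\<lambda>u. indicator {0..1} u *\<^sub>R u powr (1 - a))"
    by (rule int, rule has_integral_powr_from_0) (use a in auto)
  moreover have "integrable lborel (\<lambda>u. indicator {1..} u *\<^sub>R u powr (- a))"
    by (rule int, rule has_integral_powr_to_inf) (use a in auto)
  ultimately show "integrable lborel
      (\<lambda>u. indicator {0..1} u *\<^sub>R u powr (1 - a) + indicator {1..} u *\<^sub>R u powr (- a))"
    by (rule Bochner_Integration.integrable_add)
  show "exp_remainder_density a \<in> borel_measurable lborel"
    unfolding exp_remainder_density_def[abs_def] by measurable
  have "exp_remainder_density a u \<le> indicator {0..1} u *\<^sub>R u powr (1 - a) + indicator {1..} u *\<^sub>R u powr (- a)"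
    for u
  proof (cases "u > 0")
    case u: True
    have "(exp (- u) - 1 + u) * u powr (- 1 - a) \<le> u powr (1 - a)"
    proof -
      have "(exp (- u) - 1 + u) * u powr (- 1 - a) \<le> u powr 2 * u powr (- 1 - a)"
        using exp_remainder_le_square[OF u] u by (intro mult_right_mono) auto
      then show ?thesis by (simp add: powr_add[symmetric])
    qed
    moreover have "(exp (- u) - 1 + u) * u powr (- 1 - a) \<le> u powr (- a)"
    proof -
      have "(exp (- u) - 1 + u) * u powr (- 1 - a) \<le> u powr 1 * u powr (- 1 - a)"
        using u by (intro mult_right_mono) auto
      then show ?thesis by (simp only: powr_add[symmetric]) simp
    qed
    moreover have "exp_remainder_density a u = (exp (- u) - 1 + u) * u powr (- 1 - a)"
      using u by (simp add: exp_remainder_density_def)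
    moreover have "u powr (1 - a) \<le> indicator {0..1} u *\<^sub>R u powr (1 - a) + indicator {1..} u *\<^sub>R u powr (- a)"
      if "u \<le> 1" using that u by (simp add: indicator_def)
    moreover have "u powr (- a) \<le> indicator {0..1} u *\<^sub>R u powr (1 - a) + indicator {1..} u *\<^sub>R u powr (- a)"
      if "1 \<le> u" using that u by (simp add: indicator_def)
    ultimately show ?thesis by linarith
  qed (auto simp: exp_remainder_density_def indicator_def)
  then show "AE u in lborel. norm (exp_remainder_density a u) \<le>
      norm (indicator {0..1} u *\<^sub>R u powr (1 - a) + indicator {1..} u *\<^sub>R u powr (- a))"
    by (intro AE_I2) (simp add: exp_remainder_density_nonneg order_trans[OF _ abs_ge_self])
qed

lemma exp_remainder_scaled_integral:
  assumes a: "1 < a" "a < 2" and s: "0 \<le> s"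
  defines "F \<equiv> (\<lambda>t. indicator {0<..} t * ((exp (- (t * s)) - 1 + t * s) * t powr (- 1 - a)))"
  shows "integrable lborel F"
    and "integral\<^sup>L lborel F = s powr a * integral\<^sup>L lborel (exp_remainder_density a)"
proof -
  have "integrable lborel F \<and> integral\<^sup>L lborel F = s powr a * integral\<^sup>L lborel (exp_remainder_density a)"
  proof (cases "s = 0")
    case False
    then have s: "s > 0" using s by simp
    have F: "F t = s powr (1 + a) * exp_remainder_density a (0 + s * t)" for t
    proof (cases "t > 0")
      case True
      have "s powr (1 + a) * (s * t) powr (- 1 - a) = t powr (- 1 - a)"
        using s True by (simp add: powr_mult flip: powr_add mult.assoc)
      then show ?thesis
        using True s by (simp add: F_def exp_remainder_density_def mult_ac)
    qed (use s in \<open>auto simp: F_def exp_remainder_density_def zero_less_mult_iff\<close>)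
    have "integrable lborel (\<lambda>t. exp_remainder_density a (0 + s * t))"
      using s by (intro lborel_integrable_real_affine integrable_exp_remainder_density[OF a]) auto
    moreover have "integral\<^sup>L lborel (exp_remainder_density a) =
        s * (\<integral>t. exp_remainder_density a (0 + s * t) \<partial>lborel)"
      using lborel_integral_real_affine[of s "exp_remainder_density a" 0] s by simp
    ultimately show ?thesis
      using s by (simp add: F[abs_def] powr_add)
  qed (simp add: F_def)
  then show "integrable lborel F"
    "integral\<^sup>L lborel F = s powr a * integral\<^sup>L lborel (exp_remainder_density a)" by auto
qed

text \<open>The squared distance is the sum of a function of \<open>x\<close>, a function of \<open>y\<close> and \<open>- 2 (x \<bullet> y)\<close>; each
  part is killed by one of the two moment conditions. Hence a kernel may be changed by a multiple of it
  without effect on such weights.\<close>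
lemma pair_sum_square_norm:
  fixes c :: "'a::euclidean_space \<Rightarrow> real"
  assumes "sum c A = 0" "(\<Sum>x\<in>A. c x *\<^sub>R x) = 0"
  shows "pair_sum (\<lambda>z. (norm z)\<^sup>2) A c c = 0"
proof -
  have *: "c x * c y * (norm (x - y))\<^sup>2 = 
     (c x * (norm x)\<^sup>2) * c y + c x * (c y * (norm y)\<^sup>2) - 2 * ((c x *\<^sub>R x) \<bullet> (c y *\<^sub>R y))" for x y
    by (simp add: power2_norm_eq_inner inner_diff inner_commute algebra_simps)
  show ?thesis
    unfolding pair_sum_def * sum.distrib sum_subtractf sum_distrib_left[symmetric]
      sum_distrib_right[symmetric] inner_sum_right[symmetric] inner_sum_left[symmetric]
    using assms by simp
qed

text \<open>Insert \<open>s = |x - y|\<^sup>2\<close> and \<open>a = \<alpha> / 2\<close> into the integral representation of \<open>s powr a\<close>. On neutral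
  weights with vanishing first moment the parts \<open>1\<close> and \<open>t s\<close> drop out, leaving the integral of the
  Gaussian forms. These are nonnegative, and positive for large \<open>t\<close>.\<close>
lemma pair_sum_powr_pos:
  fixes c :: "'a::euclidean_space \<Rightarrow> real"
  assumes \<alpha>: "2 < \<alpha>" "\<alpha> < 4" and A: "finite A"
    and c: "sum c A = 0" "(\<Sum>x\<in>A. c x *\<^sub>R x) = 0" "x\<^sub>0 \<in> A" "c x\<^sub>0 \<noteq> 0"
  shows "0 < pair_sum (\<lambda>z. norm z powr \<alpha>) A c c"
proof -
  define a where "a = \<alpha> / 2"
  have a: "1 < a" "a < 2" using \<alpha> by (auto simp: a_def)
  define G where "G t = pair_sum (\<lambda>z. exp (- (t * (norm z)\<^sup>2))) A c c" for t
  define F where "F s = (\<lambda>t. indicator {0<..} t * ((exp (- (t * s)) - 1 + t * s) * t powr (- 1 - a)))"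
    for s :: real
  define H where "H t = indicator {0<..} t * (G t * t powr (- 1 - a))" for t
  define C where "C = integral\<^sup>L lborel (exp_remainder_density a)"
  have zero: "(\<Sum>x\<in>A. \<Sum>y\<in>A. c x * c y) = 0"
    using c(1) by (simp flip: sum_product)
  have H: "H t = (\<Sum>x\<in>A. \<Sum>y\<in>A. c x * c y * F ((norm (x - y))\<^sup>2) t)" for t
  proof -
    have "(\<Sum>x\<in>A. \<Sum>y\<in>A. c x * c y * (exp (- (t * (norm (x - y))\<^sup>2)) - 1 + t * (norm (x - y))\<^sup>2)) =
       G t - (\<Sum>x\<in>A. \<Sum>y\<in>A. c x * c y) + t * pair_sum (\<lambda>z. (norm z)\<^sup>2) A c c"
      unfolding G_def pair_sum_def
      by (simp add: distrib_left right_diff_distrib sum.distrib sum_subtractf sum_distrib_left mult_ac)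
    also have "\<dots> = G t"
      using zero pair_sum_square_norm[OF c(1,2)] by simp
    finally have G: "G t = (\<Sum>x\<in>A. \<Sum>y\<in>A. c x * c y *
        (exp (- (t * (norm (x - y))\<^sup>2)) - 1 + t * (norm (x - y))\<^sup>2))" ..
    show ?thesis
      unfolding H_def F_def G by (simp add: sum_distrib_left sum_distrib_right mult_ac)
  qed
  have int_F: "integrable lborel (\<lambda>t. c x * c y * F ((norm (x - y))\<^sup>2) t)" for x y
    unfolding F_def by (intro integrable_mult_right exp_remainder_scaled_integral a) auto
  have int_H: "integrable lborel H"
    unfolding H[abs_def] by (intro Bochner_Integration.integrable_sum int_F)
  have "integral\<^sup>L lborel H = (\<Sum>x\<in>A. \<Sum>y\<in>A. \<integral>t. c x * c y * F ((norm (x - y))\<^sup>2) t \<partial>lborel)"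
    unfolding H[abs_def]
    using int_F by (simp add: Bochner_Integration.integral_sum Bochner_Integration.integrable_sum
        del: integral_mult_right_zero integrable_mult_left_iff integrable_mult_right_iff)
  also have "\<dots> = (\<Sum>x\<in>A. \<Sum>y\<in>A. c x * c y * (norm (x - y) powr \<alpha> * C))"
  proof (intro sum.cong refl)
    fix x y :: 'a
    have "((norm (x - y))\<^sup>2) powr a = norm (x - y) powr \<alpha>"
      by (cases "x = y") (simp_all add: a_def powr_powr flip: powr_numeral)
    then show "(\<integral>t. c x * c y * F ((norm (x - y))\<^sup>2) t \<partial>lborel) =
        c x * c y * (norm (x - y) powr \<alpha> * C)"
      using exp_remainder_scaled_integral(2)[OF a, of "(norm (x - y))\<^sup>2"] by (simp add: F_def C_def)
  qed
  also have "\<dots> = C * pair_sum (\<lambda>z. norm z powr \<alpha>) A c c"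
    by (simp add: pair_sum_def sum_distrib_left mult_ac)
  finally have eq: "integral\<^sup>L lborel H = C * pair_sum (\<lambda>z. norm z powr \<alpha>) A c c" .
  have H_nonneg: "0 \<le> H t" for t
    using pair_sum_gaussian_nonneg[of t A c] by (auto simp: H_def G_def indicator_def)
  have "integral\<^sup>L lborel H \<noteq> 0"
  proof
    assume "integral\<^sup>L lborel H = 0"
    then have AE: "AE t in lborel. H t = 0"
      using integral_nonneg_eq_0_iff_AE[OF int_H] H_nonneg by simp
    have "0 < (\<Sum>x\<in>A. (c x)\<^sup>2)"
      using A c(3,4) by (intro sum_pos2[of A x\<^sub>0]) auto
    then have "eventually (\<lambda>t. 0 < G t) at_top"
      using pair_sum_gaussian_tendsto[OF A, of c] unfolding G_def by (rule order_tendstoD(1)[rotated])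
    then obtain T where T: "\<And>t. t \<ge> T \<Longrightarrow> 0 < G t"
      by (auto simp: eventually_at_top_linorder)
    define T' where "T' = max T 0"
    have "H t > 0" if "t \<in> {T'<..<T' + 1}" for t
      using that T[of t] by (auto simp: H_def T'_def)
    then have "AE t in lborel. t \<notin> {T'<..<T' + 1}"
      using AE by (auto elim!: eventually_mono) (metis less_irrefl)
    then have "{T'<..<T' + 1} \<in> null_sets lborel"
      by (subst AE_iff_null_sets) auto
    then show False by (simp add: null_sets_def)
  qed
  moreover have "0 \<le> integral\<^sup>L lborel H" "0 \<le> C"
    unfolding C_def by (simp_all add: H_nonneg exp_remainder_density_nonneg Bochner_Integration.integral_nonneg)
  ultimately have "0 < C * pair_sum (\<lambda>z. norm z powr \<alpha>) A c c" "0 \<le> C"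
    by (simp_all add: eq less_le)
  then show ?thesis
    by (auto simp: zero_less_mult_iff)
qed

section \<open>No finite minimiser at the critical exponent\<close>

lemma kernel_minus: "kernel \<alpha> \<beta> (- z) = kernel \<alpha> \<beta> z"
  by (simp add: kernel_def)

lemma kernel_zero: "kernel \<alpha> \<beta> 0 = 0"
  by (simp add: kernel_def)

lemma kernel_two: "kernel \<alpha> 2 z = norm z powr \<alpha> / \<alpha> - (norm z)\<^sup>2 / 2"
  by (simp add: kernel_def)

text \<open>The kernel is negative at distance one, so two equal masses at distance one have negative energy.\<close>
lemma discrete_minimizer_energy_neg:
  fixes f :: "'a::euclidean_space \<Rightarrow> real"
  assumes "0 < \<beta>" "\<beta> < \<alpha>" and min: "discrete_minimizer (kernel \<alpha> \<beta>) A f"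
  shows "pair_sum (kernel \<alpha> \<beta>) A f f < 0"
proof -
  obtain e :: 'a where e: "e \<in> Basis" using nonempty_Basis by blast
  then have ne: "norm e = 1" "e \<noteq> 0" by auto
  define g where "g x = (1 - 1/2) * dirac 0 x + 1/2 * dirac e x" for x
  have "prob_weights ({0} \<union> {e}) g"
    unfolding g_def by (rule prob_weights_combine[OF prob_weights_dirac prob_weights_dirac]) auto
  then have "pair_sum (kernel \<alpha> \<beta>) A f f \<le> pair_sum (kernel \<alpha> \<beta>) {0, e} g g"
    using min by (simp add: discrete_minimizer_def insert_commute)
  also have "\<dots> = (1 / \<alpha> - 1 / \<beta>) / 2"
    using ne kernel_minus[of \<alpha> \<beta> e] by (simp add: pair_sum_def g_def dirac_def kernel_def)
  also have "\<dots> < 0"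
    using assms by (simp add: field_simps)
  finally show ?thesis .
qed

lemma discrete_minimizer_not_point_mass:
  fixes f :: "'a::euclidean_space \<Rightarrow> real"
  assumes "0 < \<beta>" "\<beta> < \<alpha>" and min: "discrete_minimizer (kernel \<alpha> \<beta>) A f"
  obtains x where "x \<in> A" "f x > 0" "x \<noteq> c"
proof -
  note f = min[unfolded discrete_minimizer_def, THEN conjunct1]
  have "\<exists>x\<in>A. f x \<noteq> 0 \<and> x \<noteq> c"
  proof (rule ccontr)
    assume "\<not> ?thesis"
    then have *: "\<And>x. x \<in> A \<Longrightarrow> x \<noteq> c \<Longrightarrow> f x = 0" by auto
    have "f x * f y * kernel \<alpha> \<beta> (x - y) = 0" if "x \<in> A" "y \<in> A" for x y
      using *[of x] *[of y] that kernel_zero[of \<alpha> \<beta>] by (cases "x = c"; cases "y = c") auto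
    then have "pair_sum (kernel \<alpha> \<beta>) A f f = 0"
      unfolding pair_sum_def by (simp add: sum.neutral)
    then show False using discrete_minimizer_energy_neg[OF assms] by simp
  qed
  then show ?thesis using that prob_weightsD(2)[OF f] by (metis less_eq_real_def)
qed

text \<open>A sphere about the centre of mass is infinite in dimension at least two, so an isometry fixing the
  centre can carry an atom to a point outside the finite support. The weights of the copy differ
  from the original ones by a nonzero \<open>\<nu>\<close> without mass and first moment, and averaging lowers the pair
  sum by a quarter of the form at \<open>\<nu>\<close>.\<close>
lemma no_discrete_minimizer_multidim:
  fixes f :: "real ^ 'n \<Rightarrow> real"
  assumes \<alpha>: "2 < \<alpha>" "\<alpha> < 4" and n: "2 \<le> CARD('n)"
  shows "\<not> discrete_minimizer (kernel \<alpha> 2) A f"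
proof
  assume min: "discrete_minimizer (kernel \<alpha> 2) A f"
  note f = min[unfolded discrete_minimizer_def, THEN conjunct1]
  note fD = prob_weightsD[OF f]
  define K :: "real ^ 'n \<Rightarrow> real" where "K = kernel \<alpha> 2"
  define c where "c = (\<Sum>x\<in>A. f x *\<^sub>R x)"
  obtain x\<^sub>0 where x0: "x\<^sub>0 \<in> A" "f x\<^sub>0 > 0" "x\<^sub>0 \<noteq> c"
    using discrete_minimizer_not_point_mass[OF _ _ min, of c] \<alpha> by auto
  define r where "r = norm (x\<^sub>0 - c)"
  have "r > 0" using x0 by (simp add: r_def)
  have "connected (sphere c r)"
    using n by (intro connected_sphere) simp
  moreover have "sphere c r \<noteq> {p}" for p
  proof
    assume p: "sphere c r = {p}"
    have "x\<^sub>0 \<in> sphere c r" "2 *\<^sub>R c - x\<^sub>0 \<in> sphere c r"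
      by (auto simp: r_def dist_norm norm_minus_commute scaleR_2)
    then have "2 *\<^sub>R c - x\<^sub>0 = x\<^sub>0" unfolding p by simp
    then have "2 *\<^sub>R c = 2 *\<^sub>R x\<^sub>0" by (simp add: scaleR_2 algebra_simps)
    then show False using x0 by simp
  qed
  moreover have "sphere c r \<noteq> {}" using \<open>r > 0\<close> by simp
  ultimately have "infinite (sphere c r)"
    using connected_finite_iff_sing by metis
  then obtain y where y: "y \<in> sphere c r" "y \<notin> A"
    using fD(1) by (meson finite_subset subsetI)
  have "norm (x\<^sub>0 - c) = norm (y - c)"
    using y(1) by (simp add: r_def dist_norm norm_minus_commute)
  then obtain T where T: "orthogonal_transformation T" "T (x\<^sub>0 - c) = y - c"
    using orthogonal_transformation_exists by blast
  have lin: "linear T" using T(1) by (rule orthogonal_transformation_linear)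
  define S where "S x = c + T (x - c)" for x
  have S_diff: "S x - S z = T (x - z)" for x z
    by (simp add: S_def linear_diff[OF lin, symmetric])
  have norm_S: "norm (S x - S z) = norm (x - z)" for x z
    using S_diff orthogonal_transformation_norm[OF T(1)] by simp
  have inj: "inj S"
    by (rule injI) (metis norm_S right_minus_eq norm_eq_zero)
  \<comment> \<open>The push-forward of the weights under the isometry \<open>S\<close>, which fixes \<open>c\<close>.\<close>
  define g where "g z = (if z \<in> S ` A then f (inv S z) else 0)" for z
  have gS: "g (S x) = f x" if "x \<in> A" for x
    using that by (simp add: g_def inv_f_f[OF inj])
  have sum_g: "(\<Sum>z\<in>S ` A. h z) = (\<Sum>x\<in>A. h (S x))" for h :: "real ^ 'n \<Rightarrow> 'c::comm_monoid_add"
    by (rule sum.reindex[unfolded o_def]) (use inj in \<open>auto intro: inj_on_subset\<close>)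
  have "sum g (S ` A) = 1"
    using sum_g[of g] fD(4) by (simp add: gS)
  then have g: "prob_weights (S ` A) g"
    using fD(1,2) by (simp add: prob_weights_def g_def)
  note gD = prob_weightsD[OF g]
  have energy_g: "pair_sum K (S ` A) g g = pair_sum K A f f"
    unfolding pair_sum_def sum_g
    by (intro sum.cong refl) (simp add: gS K_def kernel_def norm_S)
  have "(\<Sum>z\<in>S ` A. g z *\<^sub>R z) = (\<Sum>x\<in>A. f x *\<^sub>R S x)"
    unfolding sum_g by (intro sum.cong refl) (simp add: gS)
  also have "\<dots> = (\<Sum>x\<in>A. f x *\<^sub>R c) + T (\<Sum>x\<in>A. f x *\<^sub>R (x - c))"
    by (simp add: S_def scaleR_add_right sum.distrib linear_sum[OF lin] linear_cmul[OF lin])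
  also have "(\<Sum>x\<in>A. f x *\<^sub>R (x - c)) = 0"
    by (simp add: scaleR_diff_right sum_subtractf c_def[symmetric] fD(4) flip: scaleR_sum_left)
  finally have centre_g: "(\<Sum>z\<in>S ` A. g z *\<^sub>R z) = c"
    by (simp add: fD(4) linear_0[OF lin] flip: scaleR_sum_left)
  define D where "D = A \<union> S ` A"
  have D: "finite D" "A \<subseteq> D" "S ` A \<subseteq> D" using fD(1) by (auto simp: D_def)
  define \<nu> where "\<nu> x = f x - g x" for x
  have sumD: "(\<Sum>x\<in>D. f x *\<^sub>R h x) = (\<Sum>x\<in>A. f x *\<^sub>R h x)"
    "(\<Sum>x\<in>D. g x *\<^sub>R h x) = (\<Sum>x\<in>S ` A. g x *\<^sub>R h x)" for h :: "real ^ 'n \<Rightarrow> 'c::real_vector"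
    by (rule sum.mono_neutral_right; use D fD(3) gD(3) in auto)+
  have \<nu>0: "sum \<nu> D = 0"
    using sumD[of "\<lambda>_. 1 :: real"] fD(4) gD(4) by (simp add: \<nu>_def sum_subtractf)
  have \<nu>1: "(\<Sum>x\<in>D. \<nu> x *\<^sub>R x) = 0"
    using sumD[of "\<lambda>x. x"] centre_g by (simp add: \<nu>_def scaleR_diff_left sum_subtractf c_def)
  have pos: "0 < pair_sum (\<lambda>z. norm z powr \<alpha>) D \<nu> \<nu>"
  proof (rule pair_sum_powr_pos[OF \<alpha> D(1) \<nu>0 \<nu>1])
    have "y = S x\<^sub>0" by (simp add: S_def T(2))
    then show "y \<in> D" "\<nu> y \<noteq> 0"
      using x0 y fD(3)[of y] gS[of x\<^sub>0] by (auto simp: D_def \<nu>_def)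
  qed
  have "pair_sum K D \<nu> \<nu> = pair_sum (\<lambda>z. norm z powr \<alpha>) D \<nu> \<nu> / \<alpha> - pair_sum (\<lambda>z. (norm z)\<^sup>2) D \<nu> \<nu> / 2"
    by (simp add: pair_sum_def K_def kernel_two right_diff_distrib sum_subtractf sum_divide_distrib)
  also have "\<dots> > 0"
    using pos \<alpha> pair_sum_square_norm[OF \<nu>0 \<nu>1] by simp
  finally have "pair_sum K D (\<lambda>x. f x - g x) (\<lambda>x. f x - g x) > 0"
    by (simp add: \<nu>_def[abs_def])
  moreover have "pair_sum K D f f = pair_sum K A f f"
    by (rule pair_sum_superset) (use D fD(3) in auto)
  moreover have "pair_sum K D g g = pair_sum K A f f"
    using energy_g by (subst pair_sum_superset[of D "S ` A"]) (use D gD(3) in auto)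
  ultimately have "pair_sum K D (\<lambda>x. (1 - 1/2) * f x + 1/2 * g x) (\<lambda>x. (1 - 1/2) * f x + 1/2 * g x)
      < pair_sum K A f f"
    unfolding pair_sum_interpolate by simp
  moreover have "prob_weights D (\<lambda>x. (1 - 1/2) * f x + 1/2 * g x)"
    unfolding D_def by (rule prob_weights_combine[OF f g]) auto
  ultimately show False
    using min unfolding discrete_minimizer_def K_def[symmetric] by force
qed

text \<open>At the origin the function has infinite slope, whence strictness for segments that start there. In the
  application the variable is the distance to an atom, and the strict case is that of the atom at which
  a gap begins.\<close>
lemma powr_concave_ineq:
  fixes u v \<gamma> l :: real
  assumes \<gamma>: "0 < \<gamma>" "\<gamma> < 1" and uv: "0 \<le> u" "0 \<le> v" and l: "0 < l" "l < 1"
  shows "(1 - l) * u powr \<gamma> + l * v powr \<gamma> \<le> ((1 - l) * u + l * v) powr \<gamma>"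
    and "u = 0 \<Longrightarrow> 0 < v \<Longrightarrow> (1 - l) * u powr \<gamma> + l * v powr \<gamma> < ((1 - l) * u + l * v) powr \<gamma>"
proof -
  have less: "m * w powr \<gamma> < (m * w) powr \<gamma>" if "0 < m" "m < 1" "0 < w" for m w :: real
  proof -
    have "m powr 1 < m powr \<gamma>"
      using that \<gamma> by (intro powr_less_mono') auto
    then show ?thesis using that by (simp add: powr_mult)
  qed
  show "(1 - l) * u powr \<gamma> + l * v powr \<gamma> < ((1 - l) * u + l * v) powr \<gamma>" if "u = 0" "0 < v"
    using less[of l v] that l by simp
  show "(1 - l) * u powr \<gamma> + l * v powr \<gamma> \<le> ((1 - l) * u + l * v) powr \<gamma>"
  proof (cases "u = 0 \<or> v = 0")
    case True
    then show ?thesis using less[of l v] less[of "1 - l" u] uv l by fastforce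
  next
    case False
    have "convex_on {0<..} (\<lambda>x. - (x powr \<gamma>))"
    proof (rule f''_ge0_imp_convex)
      show "((\<lambda>x. - (x powr \<gamma>)) has_real_derivative - (\<gamma> * x powr (\<gamma> - 1))) (at x)" 
        if "x \<in> {0<..}" for x
        using that by (auto intro!: derivative_eq_intros)
      show "((\<lambda>x. - (\<gamma> * x powr (\<gamma> - 1))) has_real_derivative - (\<gamma> * ((\<gamma> - 1) * x powr (\<gamma> - 1 - 1)))) (at x)"
        if "x \<in> {0<..}" for x
        using that by (auto intro!: derivative_eq_intros)
      show "- (\<gamma> * ((\<gamma> - 1) * x powr (\<gamma> - 1 - 1))) \<ge> 0" if "x \<in> {0<..}" for x
        using \<gamma> by (simp add: mult_nonneg_nonpos mult_nonpos_nonneg)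
    qed auto
    from convex_onD[OF this, of l u v] show ?thesis
      using False uv l by simp
  qed
qed

text \<open>Away from \<open>0\<close> one writes \<open>|t| powr \<gamma>\<close> as the smooth function \<open>(t\<^sup>2) powr (\<gamma> / 2)\<close>; at \<open>0\<close> the difference
  quotient is \<open>|h| powr \<gamma>\<close>.\<close>
lemma DERIV_id_times_abs_powr:
  fixes t \<gamma> :: real
  assumes "0 < \<gamma>"
  shows "((\<lambda>t. t * \<bar>t\<bar> powr \<gamma>) has_real_derivative (\<gamma> + 1) * \<bar>t\<bar> powr \<gamma>) (at t)"
proof (cases "t = 0")
  case True
  have "((\<lambda>h. \<bar>h\<bar> powr \<gamma>) \<longlongrightarrow> \<bar>0\<bar> powr \<gamma>) (at (0::real))"
    using assms by (intro tendsto_intros) auto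
  then have "((\<lambda>h. (h * \<bar>h\<bar> powr \<gamma>) / h) \<longlongrightarrow> \<bar>0\<bar> powr \<gamma>) (at 0)"
    by (rule Lim_transform_eventually) (auto simp: eventually_at_filter)
  then show ?thesis using True by (simp add: DERIV_def)
next
  case False
  have abs: "\<bar>s\<bar> powr e = (s\<^sup>2) powr (e / 2)" for s e :: real
  proof -
    have "s\<^sup>2 = \<bar>s\<bar> powr 2" by simp
    then show ?thesis by (simp only: powr_powr) simp
  qed
  have "((\<lambda>t. t * (t\<^sup>2) powr (\<gamma> / 2)) has_real_derivative
      (t\<^sup>2) powr (\<gamma> / 2) + t * (\<gamma> / 2 * (t\<^sup>2) powr (\<gamma> / 2 - 1) * (2 * t))) (at t)"
    using False by (auto intro!: derivative_eq_intros)
  moreover have "t * (\<gamma> / 2 * (t\<^sup>2) powr (\<gamma> / 2 - 1) * (2 * t)) = \<gamma> * ((t\<^sup>2) powr (\<gamma> / 2 - 1) * t\<^sup>2)"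
    by (simp add: power2_eq_square)
  moreover have "(t\<^sup>2) powr (\<gamma> / 2 - 1) * t\<^sup>2 = (t\<^sup>2) powr (\<gamma> / 2)"
    using False by (simp add: powr_diff)
  ultimately have "((\<lambda>t. t * (t\<^sup>2) powr (\<gamma> / 2)) has_real_derivative
      (t\<^sup>2) powr (\<gamma> / 2) + \<gamma> * (t\<^sup>2) powr (\<gamma> / 2)) (at t)"
    by (simp only:)
  then show ?thesis unfolding abs by (simp add: algebra_simps)
qed

lemma DERIV_abs_powr:
  fixes t \<gamma> :: real
  assumes "0 < \<gamma>"
  shows "((\<lambda>t. \<bar>t\<bar> powr (\<gamma> + 2) / (\<gamma> + 2)) has_real_derivative t * \<bar>t\<bar> powr \<gamma>) (at t)"
proof -
  have *: "\<bar>s\<bar> powr (\<gamma> + 2) = s * (s * \<bar>s\<bar> powr \<gamma>)" for s :: real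
    by (simp add: powr_add power2_eq_square mult_ac flip: mult.assoc)
  have "((\<lambda>t. t * (t * \<bar>t\<bar> powr \<gamma>) / (\<gamma> + 2)) has_real_derivative
     (t * ((\<gamma> + 1) * \<bar>t\<bar> powr \<gamma>) + 1 * (t * \<bar>t\<bar> powr \<gamma>)) / (\<gamma> + 2)) (at t)"
    by (intro DERIV_cdivide DERIV_mult' DERIV_id_times_abs_powr assms DERIV_ident)
  also have "(t * ((\<gamma> + 1) * \<bar>t\<bar> powr \<gamma>) + 1 * (t * \<bar>t\<bar> powr \<gamma>)) / (\<gamma> + 2) = t * \<bar>t\<bar> powr \<gamma>"
    using assms by (simp add: field_simps)
  finally show ?thesis unfolding * .
qed

lemma second_derivative_at_min:
  fixes \<phi> :: "real \<Rightarrow> real"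
  assumes d1: "\<And>t. (\<phi> has_real_derivative \<phi>' t) (at t)"
    and d2: "(\<phi>' has_real_derivative d) (at a)" and min: "\<And>t. \<phi> a \<le> \<phi> t"
  shows "\<phi>' a = 0" "0 \<le> d"
proof -
  show zero: "\<phi>' a = 0"
    by (rule DERIV_local_min[OF d1, of 1]) (auto simp: min)
  show "0 \<le> d"
  proof (rule ccontr)
    assume "\<not> 0 \<le> d"
    then obtain \<delta> where \<delta>: "\<delta> > 0" "\<And>h. 0 < h \<Longrightarrow> h < \<delta> \<Longrightarrow> \<phi>' (a + h) < 0"
      using DERIV_neg_dec_right[OF d2] zero by auto
    have "\<phi> (a + \<delta> / 2) < \<phi> a"
    proof (rule DERIV_neg_imp_decreasing_open[of a "a + \<delta> / 2" \<phi>])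
      show "\<exists>y. (\<phi> has_real_derivative y) (at x) \<and> y < 0" if "a < x" "x < a + \<delta> / 2" for x
        using d1[of x] \<delta>(2)[of "x - a"] \<delta>(1) that by auto
      show "continuous_on {a..a + \<delta> / 2} \<phi>"
        using d1 by (meson DERIV_isCont continuous_at_imp_continuous_on)
    qed (use \<delta> in auto)
    then show False using min[of "a + \<delta> / 2"] by simp
  qed
qed

text \<open>Identify the line with the reals and let \<open>\<phi>\<close> be the potential. All atoms minimise \<open>\<phi>\<close>, so \<open>\<phi>'\<close>
  vanishes and \<open>\<phi>''\<close> is nonnegative there. Up to a constant, \<open>\<phi>''\<close> is a positive combination of the
  functions \<open>|t - p| powr (\<alpha> - 2)\<close> for the atoms \<open>p\<close>; as \<open>\<alpha> - 2 < 1\<close> these are concave away from \<open>p\<close>.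
  Between neighbouring atoms \<open>a < b\<close> this forces \<open>\<phi>'' > 0\<close> and therefore \<open>\<phi>' a < \<phi>' b\<close>, which is absurd.\<close>
lemma no_discrete_minimizer_dim1:
  fixes f :: "'a::euclidean_space \<Rightarrow> real"
  assumes \<alpha>: "2 < \<alpha>" "\<alpha> < 3" and n: "DIM('a) = 1"
  shows "\<not> discrete_minimizer (kernel \<alpha> 2) A f"
proof
  assume min: "discrete_minimizer (kernel \<alpha> 2) A f"
  note f = min[unfolded discrete_minimizer_def, THEN conjunct1]
  note fD = prob_weightsD[OF f]
  obtain e :: 'a where e: "Basis = {e}" using n by (auto simp: card_1_singleton_iff)
  have x_e: "x = (x \<bullet> e) *\<^sub>R e" for x
    using euclidean_representation[of x] by (simp add: e)
  have "e \<in> Basis" using e by blast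
  then have ne: "norm e = 1" by simp
  define \<gamma> where "\<gamma> = \<alpha> - 2"
  have \<gamma>: "0 < \<gamma>" "\<gamma> < 1" "\<alpha> = \<gamma> + 2" using \<alpha> by (auto simp: \<gamma>_def)
  define Q where "Q = pair_sum (kernel \<alpha> 2) A f f"
  define \<phi> where "\<phi> t = (\<Sum>x\<in>A. f x * (\<bar>t - x \<bullet> e\<bar> powr (\<gamma> + 2) / (\<gamma> + 2) - (t - x \<bullet> e)\<^sup>2 / 2))" for t
  define \<phi>' where "\<phi>' t = (\<Sum>x\<in>A. f x * ((t - x \<bullet> e) * \<bar>t - x \<bullet> e\<bar> powr \<gamma> - (t - x \<bullet> e)))" for t
  define \<phi>'' where "\<phi>'' t = (\<Sum>x\<in>A. f x * ((\<gamma> + 1) * \<bar>t - x \<bullet> e\<bar> powr \<gamma> - 1))" for t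
  have \<phi>_eq: "\<phi> t = (\<Sum>x\<in>A. f x * kernel \<alpha> 2 (t *\<^sub>R e - x))" for t
  proof -
    have "norm (t *\<^sub>R e - x) = \<bar>t - x \<bullet> e\<bar>" for x
      by (subst x_e[of x]) (simp add: ne flip: scaleR_diff_left)
    then show ?thesis by (simp add: \<phi>_def kernel_two \<gamma>(3))
  qed
  have \<phi>_ge: "Q \<le> \<phi> t" for t
    unfolding Q_def \<phi>_eq by (rule discrete_minimizer_potential_ge[OF kernel_minus kernel_zero min])
  have \<phi>_atom: "\<phi> (x \<bullet> e) = Q" if "f x > 0" for x
    unfolding Q_def \<phi>_eq x_e[symmetric]
    by (rule discrete_minimizer_potential_eq[OF kernel_minus kernel_zero min that])
  have d1: "(\<phi> has_real_derivative \<phi>' t) (at t)" for t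
    unfolding \<phi>_def \<phi>'_def
    by (intro DERIV_sum DERIV_cmult DERIV_diff DERIV_chain2[OF DERIV_abs_powr[OF \<gamma>(1)], THEN DERIV_cong])
       (auto intro!: derivative_eq_intros)
  have d2: "(\<phi>' has_real_derivative \<phi>'' t) (at t)" for t
    unfolding \<phi>'_def \<phi>''_def
    by (intro DERIV_sum DERIV_cmult DERIV_diff DERIV_chain2[OF DERIV_id_times_abs_powr[OF \<gamma>(1)], THEN DERIV_cong])
       (auto intro!: derivative_eq_intros)
  define S where "S = (\<lambda>x. x \<bullet> e) ` {x \<in> A. f x > 0}"
  have atom: "\<phi>' s = 0" "0 \<le> \<phi>'' s" if "s \<in> S" for s
    using second_derivative_at_min[OF d1 d2, of s] \<phi>_ge \<phi>_atom that by (auto simp: S_def)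
  have finS: "finite S" using fD(1) by (simp add: S_def)
  obtain x\<^sub>1 where x1: "x\<^sub>1 \<in> A" "f x\<^sub>1 > 0"
    using discrete_minimizer_not_point_mass[OF _ _ min] \<alpha> by auto
  then have "S \<noteq> {}" by (auto simp: S_def)
  define a where "a = Min S"
  have a: "a \<in> S" "\<And>s. s \<in> S \<Longrightarrow> a \<le> s" using finS \<open>S \<noteq> {}\<close> by (auto simp: a_def)
  obtain x\<^sub>2 where x2: "x\<^sub>2 \<in> A" "f x\<^sub>2 > 0" "x\<^sub>2 \<noteq> a *\<^sub>R e"
    using discrete_minimizer_not_point_mass[OF _ _ min, of "a *\<^sub>R e"] \<alpha> by auto
  then have "x\<^sub>2 \<bullet> e \<in> S - {a}" using x_e[of x\<^sub>2] by (auto simp: S_def)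
  then have ne': "S - {a} \<noteq> {}" by auto
  define b where "b = Min (S - {a})"
  have b: "b \<in> S" "b \<noteq> a" using Min_in[OF _ ne'] finS by (auto simp: b_def)
  have gap: "s = a \<or> b \<le> s" if "s \<in> S" for s
  proof (cases "s = a")
    case False
    then have "Min (S - {a}) \<le> s"
      using that finS by (intro Min_le) auto
    then show ?thesis by (simp add: b_def)
  qed simp
  have ab: "a < b" using a b by force
  obtain x\<^sub>a where xa: "x\<^sub>a \<in> A" "f x\<^sub>a > 0" "x\<^sub>a \<bullet> e = a" using a(1) by (auto simp: S_def)
  have "\<phi>'' t > 0" if t: "a < t" "t < b" for t
  proof -
    define l where "l = (t - a) / (b - a)"
    have l: "0 < l" "l < 1" using t by (auto simp: l_def)
    have "l * (b - a) = t - a" using ab by (simp add: l_def)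
    then have t_l: "t = (1 - l) * a + l * b" by (simp add: algebra_simps)
    \<comment> \<open>No atom lies strictly between \<open>a\<close> and \<open>b\<close>, so the distance to an atom is affine on \<open>[a, b]\<close>.\<close>
    have dist: "\<bar>t - s\<bar> = (1 - l) * \<bar>a - s\<bar> + l * \<bar>b - s\<bar>" if "s \<in> S" for s
    proof (cases "s = a")
      case True
      then show ?thesis using l ab t by (simp add: l_def)
    next
      case False
      then have "b \<le> s" using gap that by auto
      then show ?thesis using t ab unfolding t_l by (simp add: abs_if algebra_simps)
    qed
    define G where "G x = (\<gamma> + 1) * (\<bar>t - x \<bullet> e\<bar> powr \<gamma>
      - ((1 - l) * \<bar>a - x \<bullet> e\<bar> powr \<gamma> + l * \<bar>b - x \<bullet> e\<bar> powr \<gamma>))" for x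
    have "0 < (\<Sum>x\<in>A. f x * G x)"
    proof (rule sum_pos2[OF fD(1) xa(1)])
      show "0 < f x\<^sub>a * G x\<^sub>a"
        using xa ab \<gamma> powr_concave_ineq(2)[OF \<gamma>(1,2) _ _ l, of 0 "\<bar>b - a\<bar>"] dist[OF a(1)]
        by (simp add: G_def)
      show "0 \<le> f x * G x" if "x \<in> A" for x
      proof (cases "f x > 0")
        case True
        then have "x \<bullet> e \<in> S" using that by (auto simp: S_def)
        then have "0 \<le> G x"
          using powr_concave_ineq(1)[OF \<gamma>(1,2) _ _ l, of "\<bar>a - x \<bullet> e\<bar>" "\<bar>b - x \<bullet> e\<bar>"] dist \<gamma>
          by (simp add: G_def)
        then show ?thesis using True by simp
      qed (use fD(2)[of x] in \<open>simp add: not_less\<close>)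
    qed
    also have "(\<Sum>x\<in>A. f x * G x) = \<phi>'' t - ((1 - l) * \<phi>'' a + l * \<phi>'' b)"
      unfolding \<phi>''_def G_def sum_distrib_left sum.distrib[symmetric] sum_subtractf[symmetric]
      by (intro sum.cong refl) (simp add: algebra_simps)
    finally show ?thesis
      using atom(2)[OF a(1)] atom(2)[OF b(1)] l by (smt (verit) mult_nonneg_nonneg)
  qed
  then have "\<phi>' a < \<phi>' b"
    using d2 by (intro DERIV_pos_imp_increasing_open[OF ab])
      (auto intro!: continuous_at_imp_continuous_on DERIV_isCont)
  then show False using atom(1)[OF a(1)] atom(1)[OF b(1)] by simp
qed

section \<open>Measures of finite support\<close>

text \<open>The complement of the support is the union of all open null sets, and by the Lindelof property
  countably many of them suffice.\<close>
lemma null_compl_spt: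
  fixes \<mu> :: "'a::second_countable_topology measure"
  assumes sets: "sets \<mu> = sets borel"
  shows "emeasure \<mu> (- spt \<mu>) = 0"
proof -
  define F where "F = {U. open U \<and> emeasure \<mu> U = 0}"
  have "- spt \<mu> = \<Union>F"
    by (auto simp: spt_def F_def)
  obtain F' where F': "F' \<subseteq> F" "countable F'" "\<Union>F' = \<Union>F"
    using Lindelof[of F] by (auto simp: F_def)
  have "(\<Union>U\<in>F'. U) \<in> null_sets \<mu>"
    using F' sets by (intro null_sets_UN') (auto simp: F_def null_sets_def)
  then show ?thesis using F' \<open>- spt \<mu> = \<Union>F\<close> by (simp add: null_sets_def)
qed

lemma nn_integral_finite_support:
  fixes \<mu> :: "'a::t1_space measure"
  assumes sets: "sets \<mu> = sets borel" and A: "finite A" "emeasure \<mu> (- A) = 0"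
  shows "(\<integral>\<^sup>+ x. f x \<partial>\<mu>) = (\<Sum>x\<in>A. f x * emeasure \<mu> {x})"
proof -
  have "A \<in> sets borel" using A(1) by (intro borel_closed finite_imp_closed)
  then have "- A \<in> null_sets \<mu>"
    using A sets by (auto simp: null_sets_def Compl_eq_Diff_UNIV)
  then have "AE x in \<mu>. x \<in> A"
    by (rule AE_I') auto
  then have "AE x in \<mu>. f x = (\<Sum>a\<in>A. f a * indicator {a} x)"
    by eventually_elim (use A in \<open>simp add: indicator_def if_distrib[of "\<lambda>a. _ * a"] sum.delta cong: if_cong\<close>)
  then have "(\<integral>\<^sup>+ x. f x \<partial>\<mu>) = (\<integral>\<^sup>+ x. (\<Sum>a\<in>A. f a * indicator {a} x) \<partial>\<mu>)"
    by (rule nn_integral_cong_AE)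
  also have "\<dots> = (\<Sum>a\<in>A. f a * emeasure \<mu> {a})"
  proof -
    have "{a} \<in> sets \<mu>" for a by (simp add: sets)
    then show ?thesis
      by (subst nn_integral_sum) (auto simp: nn_integral_cmult_indicator)
  qed
  finally show ?thesis .
qed

lemma nn_integral_pair_finite_support:
  fixes \<mu> :: "'a::euclidean_space measure" and h :: "'a \<times> 'a \<Rightarrow> real"
  assumes \<mu>: "\<mu> \<in> borel_prob_measures" and A: "finite A" "emeasure \<mu> (- A) = 0"
    and h: "h \<in> borel_measurable borel"
  shows "(\<integral>\<^sup>+ z. ennreal (h z) \<partial>(\<mu> \<Otimes>\<^sub>M \<mu>)) =
         ennreal (\<Sum>x\<in>A. \<Sum>y\<in>A. measure \<mu> {x} * measure \<mu> {y} * max 0 (h (x, y)))"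
proof -
  have sets: "sets \<mu> = sets borel" using \<mu> by (simp add: borel_prob_measures_def)
  interpret prob_space \<mu> using \<mu> by (simp add: borel_prob_measures_def)
  have "sets (\<mu> \<Otimes>\<^sub>M \<mu>) = sets (borel :: ('a \<times> 'a) measure)"
    using sets_pair_measure_cong[OF sets sets] by (simp only: borel_prod)
  then have "h \<in> borel_measurable (\<mu> \<Otimes>\<^sub>M \<mu>)"
    using h measurable_cong_sets by blast
  then have "(\<lambda>z. ennreal (h z)) \<in> borel_measurable (\<mu> \<Otimes>\<^sub>M \<mu>)"
    by measurable
  then have "(\<integral>\<^sup>+ z. ennreal (h z) \<partial>(\<mu> \<Otimes>\<^sub>M \<mu>)) = (\<integral>\<^sup>+ x. \<integral>\<^sup>+ y. ennreal (h (x, y)) \<partial>\<mu> \<partial>\<mu>)"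
    by (rule nn_integral_fst[symmetric])
  also have "\<dots> = (\<Sum>x\<in>A. (\<Sum>y\<in>A. ennreal (h (x, y)) * emeasure \<mu> {y}) * emeasure \<mu> {x})"
    by (simp add: nn_integral_finite_support[OF sets A])
  also have "\<dots> = (\<Sum>x\<in>A. \<Sum>y\<in>A. ennreal (measure \<mu> {x} * measure \<mu> {y} * max 0 (h (x, y))))"
  proof (intro sum.cong refl)
    fix x
    have "ennreal (h (x, y)) * emeasure \<mu> {y} * emeasure \<mu> {x} =
        ennreal (measure \<mu> {x} * measure \<mu> {y} * max 0 (h (x, y)))" for y
      by (cases "0 \<le> h (x, y)")
         (simp_all add: emeasure_eq_measure ennreal_mult[symmetric] max_def ennreal_neg mult_ac)
    then show "(\<Sum>y\<in>A. ennreal (h (x, y)) * emeasure \<mu> {y}) * emeasure \<mu> {x} =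
        (\<Sum>y\<in>A. ennreal (measure \<mu> {x} * measure \<mu> {y} * max 0 (h (x, y))))"
      by (simp add: sum_distrib_right)
  qed
  finally show ?thesis by (simp add: sum_ennreal sum_nonneg)
qed

text \<open>Where both integrals in the definition of the extended integral are finite sums, their difference
  is the plain sum.\<close>
lemma energy_finite_support:
  fixes \<mu> :: "'a::euclidean_space measure"
  assumes \<mu>: "\<mu> \<in> borel_prob_measures" and A: "finite A" "emeasure \<mu> (- A) = 0"
  shows "energy \<alpha> \<beta> \<mu> =
    ereal (pair_sum (kernel \<alpha> \<beta>) A (\<lambda>x. measure \<mu> {x}) (\<lambda>x. measure \<mu> {x}) / 2)"
proof -
  define h where "h = (\<lambda>(x, y). kernel \<alpha> \<beta> (x - y :: 'a))"
  have h: "h \<in> borel_measurable borel" "(\<lambda>z. - h z) \<in> borel_measurable borel"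
    unfolding h_def kernel_def split_def borel_prod[symmetric] by measurable
  have "ext_integral (\<mu> \<Otimes>\<^sub>M \<mu>) h = ereal
      ((\<Sum>x\<in>A. \<Sum>y\<in>A. measure \<mu> {x} * measure \<mu> {y} * max 0 (h (x, y))) -
       (\<Sum>x\<in>A. \<Sum>y\<in>A. measure \<mu> {x} * measure \<mu> {y} * max 0 (- h (x, y))))"
    unfolding ext_integral_def nn_integral_pair_finite_support[OF \<mu> A h(1)]
      nn_integral_pair_finite_support[OF \<mu> A h(2)]
    by (simp add: sum_nonneg enn2ereal_ennreal)
  also have "(\<Sum>x\<in>A. \<Sum>y\<in>A. measure \<mu> {x} * measure \<mu> {y} * max 0 (h (x, y))) -
       (\<Sum>x\<in>A. \<Sum>y\<in>A. measure \<mu> {x} * measure \<mu> {y} * max 0 (- h (x, y))) =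
      pair_sum (kernel \<alpha> \<beta>) A (\<lambda>x. measure \<mu> {x}) (\<lambda>x. measure \<mu> {x})"
    unfolding pair_sum_def sum_subtractf[symmetric] right_diff_distrib[symmetric]
    by (intro sum.cong refl) (auto simp: h_def max_def)
  finally show ?thesis by (simp add: energy_def h_def)
qed

lemma prob_weights_measure_singleton:
  fixes \<mu> :: "'a::euclidean_space measure"
  assumes \<mu>: "\<mu> \<in> borel_prob_measures" and A: "finite A" "emeasure \<mu> (- A) = 0"
  shows "prob_weights A (\<lambda>x. measure \<mu> {x})"
proof -
  have sets: "sets \<mu> = sets borel" using \<mu> by (simp add: borel_prob_measures_def)
  interpret prob_space \<mu> using \<mu> by (simp add: borel_prob_measures_def)
  have A_sets: "A \<in> sets \<mu>" using A(1) sets by (auto intro: borel_closed finite_imp_closed)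
  have "space \<mu> = UNIV" using sets_eq_imp_space_eq[OF sets] by simp
  then have "measure \<mu> A = 1"
    using A(2) prob_compl[OF A_sets] by (simp add: measure_def Compl_eq_Diff_UNIV)
  moreover have "measure \<mu> A = (\<Sum>x\<in>A. measure \<mu> {x})"
    using A(1) by (intro finite_measure_eq_sum_singleton) (auto simp: sets)
  moreover have "measure \<mu> {x} = 0" if "x \<notin> A" for x
  proof -
    have "emeasure \<mu> {x} \<le> emeasure \<mu> (- A)"
      using that A_sets by (intro emeasure_mono) (auto simp: sets)
    then show ?thesis using A(2) by (simp add: measure_def)
  qed
  ultimately show ?thesis using A(1) by (simp add: prob_weights_def)
qed

lemma prob_weights_imp_measure:
  fixes f :: "'a::euclidean_space \<Rightarrow> real"
  assumes f: "prob_weights A f"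
  obtains \<mu> where "\<mu> \<in> borel_prob_measures" "emeasure \<mu> (- A) = 0" "\<And>x. measure \<mu> {x} = f x"
proof -
  note fD = prob_weightsD[OF f]
  define P where "P = point_measure A (\<lambda>x. ennreal (f x))"
  define \<mu> where "\<mu> = distr P borel (\<lambda>x. x)"
  have meas: "(\<lambda>x. x) \<in> measurable P borel"
    by (auto simp: P_def measurable_point_measure_eq1)
  have em: "emeasure \<mu> X = ennreal (sum f (X \<inter> A))" if "X \<in> sets borel" for X
  proof -
    have "emeasure \<mu> X = emeasure P (X \<inter> A)"
      unfolding \<mu>_def using that by (subst emeasure_distr[OF meas]) (auto simp: P_def space_point_measure)
    also have "\<dots> = ennreal (sum f (X \<inter> A))"
      unfolding P_def using fD by (subst emeasure_point_measure_finite) auto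
    finally show ?thesis .
  qed
  have "prob_space \<mu>"
    by (rule prob_spaceI) (use em[of UNIV] fD(4) in \<open>simp add: \<mu>_def\<close>)
  then have 1: "\<mu> \<in> borel_prob_measures" by (simp add: borel_prob_measures_def \<mu>_def)
  have "- A \<in> sets borel" using fD(1) by (intro borel_comp borel_closed finite_imp_closed)
  then have 2: "emeasure \<mu> (- A) = 0" using em by simp
  have 3: "measure \<mu> {x} = f x" for x
    using em[of "{x}"] fD(2)[of x] fD(3)[of x] by (cases "x \<in> A") (auto simp: measure_def)
  show ?thesis by (rule that[OF 1 2 3])
qed

text \<open>A measure of finite support is determined by its point masses, and every finite configuration comes
  from a measure; so minimality descends to finite configurations.\<close>
lemma minimizer_imp_discrete_minimizer:
  fixes \<mu> :: "'a::euclidean_space measure"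
  assumes min: "\<mu> \<in> minimizers \<alpha> \<beta>" and fin: "finite (spt \<mu>)"
  shows "discrete_minimizer (kernel \<alpha> \<beta>) (spt \<mu>) (\<lambda>x. measure \<mu> {x})"
proof -
  have \<mu>: "\<mu> \<in> borel_prob_measures"
    and least: "\<And>\<nu> :: 'a measure. \<nu> \<in> borel_prob_measures \<Longrightarrow> energy \<alpha> \<beta> \<mu> \<le> energy \<alpha> \<beta> \<nu>"
    using min by (auto simp: minimizers_def is_arg_min_def not_less)
  have null: "emeasure \<mu> (- spt \<mu>) = 0"
    using \<mu> by (intro null_compl_spt) (simp add: borel_prob_measures_def)
  show ?thesis
    unfolding discrete_minimizer_def
  proof (intro conjI allI impI)
    show "prob_weights (spt \<mu>) (\<lambda>x. measure \<mu> {x})"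
      by (rule prob_weights_measure_singleton[OF \<mu> fin null])
    fix B and g :: "'a \<Rightarrow> real"
    assume g: "prob_weights B g"
    obtain \<nu> where \<nu>: "\<nu> \<in> borel_prob_measures" "emeasure \<nu> (- B) = 0" "\<And>x. measure \<nu> {x} = g x"
      using prob_weights_imp_measure[OF g] by blast
    have "energy \<alpha> \<beta> \<mu> \<le> energy \<alpha> \<beta> \<nu>" by (rule least[OF \<nu>(1)])
    then show "pair_sum (kernel \<alpha> \<beta>) (spt \<mu>) (\<lambda>x. measure \<mu> {x}) (\<lambda>x. measure \<mu> {x})
        \<le> pair_sum (kernel \<alpha> \<beta>) B g g"
      using energy_finite_support[OF \<mu> fin null] prob_weightsD(1)[OF g]
        energy_finite_support[OF \<nu>(1) _ \<nu>(2)] by (simp add: \<nu>(3))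
  qed
qed

section \<open>Compactness of minimisers with few atoms\<close>

text \<open>By Young's inequality the kernel is at least its value \<open>1 / \<alpha> - 1 / \<beta>\<close> at distance one,
  and \<open>\<beta> \<ge> 2\<close>.\<close>
lemma kernel_ge:
  assumes "2 \<le> \<beta>" "\<beta> < \<alpha>"
  shows "- (1/2) \<le> kernel \<alpha> \<beta> z"
proof (cases "z = 0")
  case False
  have "(norm z powr \<alpha>) powr (\<beta> / \<alpha>) * 1 powr (1 - \<beta> / \<alpha>) \<le> \<beta> / \<alpha> * norm z powr \<alpha> + (1 - \<beta> / \<alpha>) * 1"
    using assms False by (intro Youngs_inequality_0) auto
  then have "norm z powr \<beta> \<le> \<beta> / \<alpha> * norm z powr \<alpha> + (1 - \<beta> / \<alpha>)"
    using assms by (simp add: powr_powr)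
  then have "norm z powr \<beta> / \<beta> \<le> (\<beta> / \<alpha> * norm z powr \<alpha> + (1 - \<beta> / \<alpha>)) / \<beta>"
    using assms by (intro divide_right_mono) auto
  also have "\<dots> = norm z powr \<alpha> / \<alpha> + (1 / \<beta> - 1 / \<alpha>)"
    using assms by (simp add: field_simps)
  also have "1 / \<beta> - 1 / \<alpha> \<le> 1 / 2"
    using assms frac_le[of 1 1 2 \<beta>] by (simp add: add_increasing2 diff_le_eq)
  finally show ?thesis by (simp add: kernel_def)
qed (simp add: kernel_def)

text \<open>Beyond distance one the subtracted term is at most \<open>|z| powr b / 2\<close> for every \<open>\<beta>\<close> between \<open>2\<close> and
  \<open>b\<close>, which makes the growth of the kernel uniform in \<open>\<beta>\<close>.\<close>
lemma kernel_large:
  assumes b: "2 \<le> b" "b < \<alpha>" and M: "0 \<le> M"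
  obtains R where "\<And>\<beta> z. 2 \<le> \<beta> \<Longrightarrow> \<beta> \<le> b \<Longrightarrow> R < norm z \<Longrightarrow> M < kernel \<alpha> \<beta> z"
proof
  define L where "L = \<alpha> * (1 / 2 + M)"
  have L: "0 < L" using b M by (auto simp: L_def)
  fix \<beta> :: real and z :: 'a
  assume \<beta>: "2 \<le> \<beta>" "\<beta> \<le> b" and z: "max 1 (L powr (1 / (\<alpha> - b))) < norm z"
  have "L = (L powr (1 / (\<alpha> - b))) powr (\<alpha> - b)"
    using b L by (simp add: powr_powr)
  also have "\<dots> < norm z powr (\<alpha> - b)"
    using z b by (intro powr_less_mono2) auto
  finally have "1 / 2 + M < norm z powr (\<alpha> - b) / \<alpha>"
    using b by (simp add: L_def pos_less_divide_eq mult_ac)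
  moreover have zb: "1 \<le> norm z powr b"
    using z b by (intro ge_one_powr_ge_zero) auto
  ultimately have "M < norm z powr b * (norm z powr (\<alpha> - b) / \<alpha> - 1 / 2)"
    using M by (smt (verit) mult_le_cancel_right1)
  also have "\<dots> = norm z powr \<alpha> / \<alpha> - norm z powr b / 2"
    by (simp add: right_diff_distrib flip: powr_add)
  also have "norm z powr \<beta> / \<beta> \<le> norm z powr b / 2"
    using \<beta> z by (intro frac_le powr_mono) auto
  then have "norm z powr \<alpha> / \<alpha> - norm z powr b / 2 \<le> kernel \<alpha> \<beta> z"
    by (simp add: kernel_def)
  finally show "M < kernel \<alpha> \<beta> z" .
qed

text \<open>At an atom \<open>p\<close> the potential is at most \<open>0\<close>. By pigeonhole some atom \<open>c\<close> has mass at least \<open>1 / N\<close>.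
  All other atoms together contribute at least \<open>- 1/2\<close> to the potential at \<open>p\<close>, so the kernel at
  \<open>p - c\<close> is at most \<open>N / 2\<close>, however small the mass of \<open>p\<close> is.\<close>
lemma discrete_minimizer_diameter:
  fixes \<alpha> b :: real
  assumes b: "2 \<le> b" "b < \<alpha>"
  obtains R where "\<And>\<beta> (A :: 'a::euclidean_space set) f x y. 2 \<le> \<beta> \<Longrightarrow> \<beta> \<le> b \<Longrightarrow>
     discrete_minimizer (kernel \<alpha> \<beta>) A f \<Longrightarrow> card A \<le> N \<Longrightarrow> f x > 0 \<Longrightarrow> f y > 0 \<Longrightarrow> norm (x - y) \<le> R"
proof -
  obtain R where R: "\<And>\<beta> (z :: 'a). 2 \<le> \<beta> \<Longrightarrow> \<beta> \<le> b \<Longrightarrow> R < norm z \<Longrightarrow> real N / 2 < kernel \<alpha> \<beta> z"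
    using kernel_large[OF b, of "real N / 2"] by auto
  show ?thesis
  proof (rule that[of "R + R"])
    fix \<beta> and A :: "'a set" and f x y
    assume \<beta>: "2 \<le> \<beta>" "\<beta> \<le> b" and min: "discrete_minimizer (kernel \<alpha> \<beta>) A f"
      and N: "card A \<le> N" and xy: "f x > 0" "f y > 0"
    note f = min[unfolded discrete_minimizer_def, THEN conjunct1]
    note fD = prob_weightsD[OF f]
    have "\<exists>c\<in>A. 1 \<le> N * f c"
    proof (rule ccontr)
      assume "\<not> ?thesis"
      then have "(\<Sum>c\<in>A. N * f c) < (\<Sum>c\<in>A. 1)"
        using fD(1,4) by (intro sum_strict_mono) force+
      then show False using fD(4) N by (simp flip: sum_distrib_left)
    qed
    then obtain c where c: "c \<in> A" "1 \<le> N * f c" by blast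
    have "norm (p - c) \<le> R" if p: "f p > 0" for p
    proof (rule ccontr)
      assume "\<not> norm (p - c) \<le> R"
      then have K: "real N / 2 < kernel \<alpha> \<beta> (p - c)" using R[OF \<beta>] by simp
      have "(\<Sum>x\<in>A. f x * kernel \<alpha> \<beta> (p - x)) \<le> 0"
        using discrete_minimizer_potential_eq[OF kernel_minus kernel_zero min p]
          discrete_minimizer_energy_le_0[OF kernel_zero min] by simp
      moreover have "(\<Sum>x\<in>A. f x * kernel \<alpha> \<beta> (p - x)) =
          f c * kernel \<alpha> \<beta> (p - c) + (\<Sum>x\<in>A - {c}. f x * kernel \<alpha> \<beta> (p - x))"
        by (rule sum.remove[OF fD(1) c(1)])
      moreover have "(\<Sum>x\<in>A - {c}. f x * - (1/2)) \<le> (\<Sum>x\<in>A - {c}. f x * kernel \<alpha> \<beta> (p - x))"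
        using \<beta> b fD(2) by (intro sum_mono mult_left_mono kernel_ge) auto
      moreover have "(\<Sum>x\<in>A - {c}. f x * - (1/2)) = - (1 - f c) / 2"
        using fD(4) sum.remove[OF fD(1) c(1), of f] unfolding sum_distrib_right[symmetric] by simp
      moreover have "1 / 2 < f c * kernel \<alpha> \<beta> (p - c)"
      proof -
        have "f c > 0" using c(2) by (smt (verit) fD(2) mult_eq_0_iff)
        then have "f c * (real N / 2) < f c * kernel \<alpha> \<beta> (p - c)"
          using K by simp
        then show ?thesis using c(2) by (simp add: mult.commute)
      qed
      ultimately show False using fD(2)[of c] by simp
    qed
    from this[OF xy(1)] this[OF xy(2)] show "norm (x - y) \<le> R + R"
      using norm_triangle_ineq4[of "x - c" "y - c"] by simp
  qed
qed

lemma finite_product_convergent_subsequence: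
  fixes u :: "nat \<Rightarrow> nat \<Rightarrow> 'b::heine_borel"
  assumes "\<And>i. i < N \<Longrightarrow> bounded (range (\<lambda>k. u k i))"
  shows "\<exists>r l. strict_mono (r :: nat \<Rightarrow> nat) \<and> (\<forall>i<N. (\<lambda>k. u (r k) i) \<longlonglongrightarrow> l i)"
  using assms
proof (induction N)
  case 0
  show ?case by (intro exI[of _ id] exI) (auto simp: strict_mono_def)
next
  case (Suc N)
  then obtain r l where r: "strict_mono (r :: nat \<Rightarrow> nat)" "\<forall>i<N. (\<lambda>k. u (r k) i) \<longlonglongrightarrow> l i"
    by (metis less_Suc_eq)
  have "bounded (range (\<lambda>k. u (r k) N))"
    using Suc.prems[of N, OF lessI] by (rule bounded_subset) auto
  then obtain l' r' where r': "strict_mono (r' :: nat \<Rightarrow> nat)" "((\<lambda>k. u (r k) N) \<circ> r') \<longlonglongrightarrow> l'"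
    using bounded_imp_convergent_subsequence by blast
  define l'' where "l'' i = (if i = N then l' else l i)" for i
  have "(\<lambda>k. u ((r \<circ> r') k) i) \<longlonglongrightarrow> l'' i" if "i < Suc N" for i
    using that r' LIMSEQ_subseq_LIMSEQ[OF r(2)[rule_format] r'(1), of i]
    by (auto simp: o_def less_Suc_eq l''_def)
  then show ?case
    using strict_mono_o[OF r(1) r'(1)] by (intro exI[of _ "r \<circ> r'"] exI[of _ l''] conjI allI impI)
qed

lemma tendsto_kernel:
  assumes "(b \<longlongrightarrow> \<beta>) F" "(z \<longlongrightarrow> w) F" "0 < \<alpha>" "0 < \<beta>"
  shows "((\<lambda>k. kernel \<alpha> (b k) (z k)) \<longlongrightarrow> kernel \<alpha> \<beta> w) F"
  unfolding kernel_def
  using assms by (auto intro!: tendsto_intros)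

text \<open>Compactness. A limit of minimisers with at most \<open>N\<close> points, taken relative to one of their atoms and
  along \<open>\<beta> \<rightarrow> 2\<close>, would be a minimiser for \<open>\<beta> = 2\<close>: the energies of the minimisers and those of any
  fixed competitor both pass to the limit.\<close>
lemma discrete_minimizer_card_unbounded:
  fixes \<alpha> :: real
  assumes \<alpha>: "2 < \<alpha>"
    and no_min: "\<And>(A :: 'a::euclidean_space set) f. \<not> discrete_minimizer (kernel \<alpha> 2) A f"
  shows "\<exists>b>2. \<forall>\<beta> (A :: 'a set) f. 2 < \<beta> \<and> \<beta> < b \<and> discrete_minimizer (kernel \<alpha> \<beta>) A f \<longrightarrow> N < card A"
proof (rule ccontr)
  assume contr: "\<not> ?thesis"
  define c where "c = (\<alpha> - 2) / 2"
  have c: "0 < c" "2 + c < \<alpha>" using \<alpha> by (auto simp: c_def field_simps)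
  have "\<exists>\<beta> (A :: 'a set) f. 2 < \<beta> \<and> \<beta> < 2 + c / Suc k \<and> discrete_minimizer (kernel \<alpha> \<beta>) A f \<and> card A \<le> N"
    for k
  proof -
    have "2 < 2 + c / Suc k" using c(1) by simp
    then show ?thesis using contr by (metis not_less)
  qed
  then obtain \<beta> A f where \<beta>: "\<And>k. 2 < \<beta> k" "\<And>k. \<beta> k < 2 + c / Suc k"
    and min: "\<And>k. discrete_minimizer (kernel \<alpha> (\<beta> k)) (A k :: 'a set) (f k)"
    and N: "\<And>k. card (A k) \<le> N"
    by metis
  have \<beta>_le: "\<beta> k \<le> 2 + c" for k
  proof -
    have "c / Suc k \<le> c / 1" using c(1) by (intro divide_left_mono) auto
    then show ?thesis using \<beta>(2)[of k] by simp
  qed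
  have \<beta>_lim: "\<beta> \<longlonglongrightarrow> 2"
  proof (rule tendsto_sandwich[OF _ _ tendsto_const])
    show "(\<lambda>k. 2 + c / Suc k) \<longlonglongrightarrow> 2"
      using tendsto_add[OF tendsto_const[of 2] LIMSEQ_Suc[OF lim_const_over_n[of c]]] by simp
  qed (use \<beta> in \<open>auto intro!: always_eventually less_imp_le\<close>)
  obtain R where R: "\<And>\<beta> (A :: 'a set) f x y. 2 \<le> \<beta> \<Longrightarrow> \<beta> \<le> 2 + c \<Longrightarrow>
     discrete_minimizer (kernel \<alpha> \<beta>) A f \<Longrightarrow> card A \<le> N \<Longrightarrow> f x > 0 \<Longrightarrow> f y > 0 \<Longrightarrow> norm (x - y) \<le> R"
    using discrete_minimizer_diameter[of "2 + c" \<alpha> N] c by auto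
  define is_tuple where "is_tuple k m p \<longleftrightarrow>
    (\<forall>i. 0 \<le> m i \<and> m i \<le> 1 \<and> p i \<in> {x \<in> A k. f k x > 0}) \<and> (\<Sum>i<N. m i) = 1 \<and>
    (\<forall>h. (\<Sum>x\<in>A k. f k x * h x) = (\<Sum>i<N. m i * h (p i)))" for k m p
  have "\<exists>m p. is_tuple k m p" for k
  proof -
    have "prob_weights (A k) (f k)" using min[of k] by (simp add: discrete_minimizer_def)
    then show ?thesis
      unfolding is_tuple_def
      by (rule prob_weights_imp_tuple[OF _ N[of k]]) (intro exI conjI allI; assumption)
  qed
  then obtain m p where tuple: "\<And>k. is_tuple k (m k) (p k)"
    by metis
  then have mp: "\<And>k i. 0 \<le> m k i" "\<And>k i. m k i \<le> 1" "\<And>k i. p k i \<in> {x \<in> A k. f k x > 0}"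
    "\<And>k. (\<Sum>i<N. m k i) = 1"
    "\<And>k h. (\<Sum>x\<in>A k. f k x * h x) = (\<Sum>i<N. m k i * h (p k i))"
    by (simp_all add: is_tuple_def)
  \<comment> \<open>The energy is translation invariant, so positions matter only relative to one atom.\<close>
  define q where "q k i = p k i - p k 0" for k i
  have bdd: "bounded (range (\<lambda>k. (m k i, q k i)))" for i
  proof -
    have "norm (m k i, q k i) \<le> 1 + R" for k
    proof -
      have "norm (q k i) \<le> R"
        unfolding q_def using mp(3) \<beta>(1)[of k] \<beta>_le[of k] N[of k] by (intro R[OF _ _ min[of k]]) auto
      then show ?thesis
        using norm_Pair_le[of "m k i" "q k i"] mp(1,2)[of k i] by simp
    qed
    then show ?thesis unfolding bounded_iff by auto
  qed
  obtain r l where r: "strict_mono (r :: nat \<Rightarrow> nat)"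
    and l: "\<forall>i<N. (\<lambda>k. (m (r k) i, q (r k) i)) \<longlonglongrightarrow> l i"
    using finite_product_convergent_subsequence[of N "\<lambda>k i. (m k i, q k i)", OF bdd] by auto
  define m' q' where "m' i = fst (l i)" and "q' i = snd (l i)" for i
  have lim: "(\<lambda>k. m (r k) i) \<longlonglongrightarrow> m' i" "(\<lambda>k. q (r k) i) \<longlonglongrightarrow> q' i" if "i < N" for i
    using tendsto_fst[OF l[rule_format, OF that]] tendsto_snd[OF l[rule_format, OF that]]
    by (simp_all add: m'_def q'_def)
  have \<beta>r: "(\<lambda>k. \<beta> (r k)) \<longlonglongrightarrow> 2"
    using LIMSEQ_subseq_LIMSEQ[OF \<beta>_lim r] by (simp add: o_def)
  have "0 \<le> m' i" if "i < N" for i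
    by (rule LIMSEQ_le_const[OF lim(1)[OF that]]) (use mp(1) in auto)
  moreover have "(\<Sum>i<N. m' i) = 1"
  proof (rule LIMSEQ_unique)
    show "(\<lambda>k. \<Sum>i<N. m (r k) i) \<longlonglongrightarrow> (\<Sum>i<N. m' i)"
      by (intro tendsto_sum lim(1)) simp
  qed (simp add: mp(4))
  ultimately obtain g where g: "prob_weights (q' ` {..<N}) g"
    "\<And>h. (\<Sum>x\<in>q' ` {..<N}. g x * h x) = (\<Sum>i<N. m' i * h (q' i))"
    using tuple_imp_prob_weights[of N m' q'] by metis
  define E where "E = pair_sum (kernel \<alpha> 2) (q' ` {..<N}) g g"
  have E: "E = (\<Sum>i<N. \<Sum>j<N. m' i * m' j * kernel \<alpha> 2 (q' i - q' j))"
    unfolding E_def by (rule pair_sum_tuple) (rule g(2))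
  obtain C :: "'a set" and h where h: "prob_weights C h" "pair_sum (kernel \<alpha> 2) C h h < E"
    using no_min[of "q' ` {..<N}" g] g(1) by (auto simp: discrete_minimizer_def E_def not_le)
  have "E \<le> pair_sum (kernel \<alpha> 2) C h h"
  proof (rule LIMSEQ_le)
    show "(\<lambda>k. \<Sum>i<N. \<Sum>j<N. m (r k) i * m (r k) j * kernel \<alpha> (\<beta> (r k)) (q (r k) i - q (r k) j)) \<longlonglongrightarrow> E"
      unfolding E using \<alpha> by (intro tendsto_intros lim tendsto_kernel \<beta>r) auto
    show "(\<lambda>k. pair_sum (kernel \<alpha> (\<beta> (r k))) C h h) \<longlonglongrightarrow> pair_sum (kernel \<alpha> 2) C h h"
      unfolding pair_sum_def using \<alpha> by (intro tendsto_intros tendsto_kernel \<beta>r) auto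
    have "(\<Sum>i<N. \<Sum>j<N. m k i * m k j * kernel \<alpha> (\<beta> k) (q k i - q k j)) \<le> pair_sum (kernel \<alpha> (\<beta> k)) C h h" for k
    proof -
      have "pair_sum (kernel \<alpha> (\<beta> k)) (A k) (f k) (f k) =
          (\<Sum>i<N. \<Sum>j<N. m k i * m k j * kernel \<alpha> (\<beta> k) (p k i - p k j))"
        by (rule pair_sum_tuple) (rule mp(5))
      then show ?thesis
        using min[of k] h(1) by (simp add: discrete_minimizer_def q_def)
    qed
    then show "\<exists>k\<^sub>0. \<forall>k\<ge>k\<^sub>0. (\<Sum>i<N. \<Sum>j<N. m (r k) i * m (r k) j * kernel \<alpha> (\<beta> (r k)) (q (r k) i - q (r k) j))
        \<le> pair_sum (kernel \<alpha> (\<beta> (r k))) C h h" by blast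
  qed
  with h(2) show False by simp
qed

section \<open>Divergence of the number of atoms\<close>

theorem theorem1p9:
  fixes \<alpha> :: real
  assumes "CARD('n::finite) = 1 \<Longrightarrow> \<alpha> \<in> {2<..<3}"
    and "CARD('n) \<ge> 2 \<Longrightarrow> \<alpha> \<in> {2<..<4}"
  shows "((\<lambda>\<beta>. Inf {ecard (spt \<mu>) | \<mu> :: (real ^ 'n) measure. \<mu> \<in> minimizers \<alpha> \<beta>})
           \<longlongrightarrow> \<infinity>) (at_right 2)"
proof -
  have cases: "CARD('n) = 1 \<or> 2 \<le> CARD('n)"
    using zero_less_card_finite[where 'a = 'n] by linarith
  then have \<alpha>: "2 < \<alpha>" using assms by auto
  have no_min: "\<not> discrete_minimizer (kernel \<alpha> 2) A f" for A :: "(real ^ 'n) set" and f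
    using cases
  proof
    assume n: "CARD('n) = 1"
    show ?thesis
      by (rule no_discrete_minimizer_dim1) (use assms(1)[OF n] n in auto)
  next
    assume n: "2 \<le> CARD('n)"
    show ?thesis
      by (rule no_discrete_minimizer_multidim) (use assms(2)[OF n] n in auto)
  qed
  show ?thesis
  proof (rule order_tendstoI)
    fix a :: enat
    assume "a < \<infinity>"
    then obtain N where N: "a = enat N" by (cases a) auto
    obtain b where b: "2 < b" "\<And>\<beta> (A :: (real ^ 'n) set) f. 2 < \<beta> \<Longrightarrow> \<beta> < b \<Longrightarrow>
        discrete_minimizer (kernel \<alpha> \<beta>) A f \<Longrightarrow> N < card A"
      using discrete_minimizer_card_unbounded[OF \<alpha> no_min, of N] by auto
    have "a < Inf {ecard (spt \<mu>) | \<mu> :: (real ^ 'n) measure. \<mu> \<in> minimizers \<alpha> \<beta>}"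
      if \<beta>: "2 < \<beta>" "\<beta> < b" for \<beta>
    proof -
      have "enat (Suc N) \<le> ecard (spt \<mu>)" if \<mu>: "\<mu> \<in> minimizers \<alpha> \<beta>" for \<mu> :: "(real ^ 'n) measure"
        using b(2)[OF \<beta> minimizer_imp_discrete_minimizer[OF \<mu>]] by (auto simp: ecard_def)
      then have "enat (Suc N) \<le> Inf {ecard (spt \<mu>) | \<mu> :: (real ^ 'n) measure. \<mu> \<in> minimizers \<alpha> \<beta>}"
        by (intro Inf_greatest) auto
      then show ?thesis unfolding N by (rule less_le_trans[rotated]) simp
    qed
    then show "\<forall>\<^sub>F \<beta> in at_right 2.
        a < Inf {ecard (spt \<mu>) | \<mu> :: (real ^ 'n) measure. \<mu> \<in> minimizers \<alpha> \<beta>}"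
      using b(1) unfolding eventually_at_right_field by (intro exI[of _ b]) auto
  qed simp
qed

end
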